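(* Assume $a$ is (WD) or (SD), let $\beta,\gamma\ge0$, and let $y$ be a classical solution of problem (P). Then the energy $E_y$ is non increasing; more precisely, $$\frac{dE_y(t)}{dt}=-y_t^2(t,1)-y_{tx}^2(t,1)\qquad\forall t\ge0.$$
   Context: $a$ is weakly degenerate (WD) if $a\in C[0,1]\cap C^1(0,1]$, $a(0)=0$, $a>0$ on $(0,1]$ and $K:=\sup_{x\in(0,1]}\frac{x|a'(x)|}{a(x)}\in(0,1)$; $a$ is strongly degenerate (SD) if $a\in C^1[0,1]$, $a(0)=0$, $a>0$ on $(0,1]$ and $K\in[1,2)$. Spaces: $L^2_{\frac1a}(0,1):=\{u\in L^2(0,1):\int_0^1u^2/a<\infty\}$; $H^2_{\frac1a,0}(0,1):=\{u\in L^2_{\frac1a}(0,1)\cap H^2(0,1):u(0)=u'(0)=0\}$; $D(A):=\{u\in H^2_{\frac1a,0}(0,1):au''''\in L^2_{\frac1a}(0,1)\}$. Problem (P): $y_{tt}+a(x)y_{xxxx}=0$ for $t>0$, $x\in(0,1)$; $y(t,0)=y_x(t,0)=0$; $\beta y(t,1)-y_{xxx}(t,1)+y_t(t,1)=0$; $\gamma y_x(t,1)+y_{xx}(t,1)+y_{tx}(t,1)=0$; $y(0,x)=y_0(x)$, $y_t(0,x)=y_1(x)$. A classical solution is a function $y\in C^2([0,\infty);L^2_{\frac1a}(0,1))\cap C^1([0,\infty);H^2_{\frac1a,0}(0,1))\cap C([0,\infty);D(A))$ satisfying the equation and all boundary conditions of (P) for every $t\ge0$ (this is the solution obtained for initial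 data $(y_0,y_1)$ in $D(A)\times H^2_{\frac1a,0}(0,1)$ satisfying the two boundary conditions at $x=1$ with $y_1$ in place of $y_t$). Energy: $E_y(t):=\frac12\int_0^1\big(\frac{y_t^2(t,x)}{a(x)}+y_{xx}^2(t,x)\big)dx+\frac\beta2y^2(t,1)+\frac\gamma2y_x^2(t,1)$. *)

theory Defs
  imports "HOL-Analysis.Analysis"
begin

definition Kconst :: "(real \<Rightarrow> real) \<Rightarrow> (real \<Rightarrow> real) \<Rightarrow> real" where
  "Kconst a a' = Sup ((\<lambda>x. x * \<bar>a' x\<bar> / a x) ` {0<..1})"

definition WD :: "(real \<Rightarrow> real) \<Rightarrow> bool" where
  "WD a \<longleftrightarrow> continuous_on {0..1} a \<and> a 0 = 0 \<and> (\<forall>x\<in>{0<..1}. a x > 0) \<and>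
     (\<exists>a'. continuous_on {0<..1} a' \<and>
        (\<forall>x\<in>{0<..1}. (a has_real_derivative a' x) (at x within {0<..1})) \<and>
        bdd_above ((\<lambda>x. x * \<bar>a' x\<bar> / a x) ` {0<..1}) \<and>
        0 < Kconst a a' \<and> Kconst a a' < 1)"

definition SD :: "(real \<Rightarrow> real) \<Rightarrow> bool" where
  "SD a \<longleftrightarrow> a 0 = 0 \<and> (\<forall>x\<in>{0<..1}. a x > 0) \<and>
     (\<exists>a'. continuous_on {0..1} a' \<and>
        (\<forall>x\<in>{0..1}. (a has_real_derivative a' x) (at x within {0..1})) \<and>
        bdd_above ((\<lambda>x. x * \<bar>a' x\<bar> / a x) ` {0<..1}) \<and>
        1 \<le> Kconst a a' \<and> Kconst a a' < 2)"

definition L2 :: "(real \<Rightarrow> real) \<Rightarrow> bool" where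
  "L2 u \<longleftrightarrow> set_borel_measurable lborel {0<..<1} u \<and>
            set_integrable lborel {0<..<1} (\<lambda>x. (u x)\<^sup>2)"

definition L2w :: "(real \<Rightarrow> real) \<Rightarrow> (real \<Rightarrow> real) \<Rightarrow> bool" where
  "L2w a u \<longleftrightarrow> L2 u \<and> set_integrable lborel {0<..<1} (\<lambda>x. (u x)\<^sup>2 / a x)"

definition nrm2w :: "(real \<Rightarrow> real) \<Rightarrow> (real \<Rightarrow> real) \<Rightarrow> real" where
  "nrm2w a u = (LINT x:{0<..<1}|lborel. (u x)\<^sup>2 / a x)"

definition nrm2 :: "(real \<Rightarrow> real) \<Rightarrow> real" where
  "nrm2 u = (LINT x:{0<..<1}|lborel. (u x)\<^sup>2)"

definition test_fun :: "real \<Rightarrow> real \<Rightarrow> (real \<Rightarrow> real) \<Rightarrow> bool" where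
  "test_fun p q \<phi> \<longleftrightarrow> (\<forall>k x. ((deriv ^^ k) \<phi>) differentiable (at x)) \<and>
     (\<exists>c d. p < c \<and> c \<le> d \<and> d < q \<and> (\<forall>x. x \<notin> {c..d} \<longrightarrow> \<phi> x = 0))"

definition weak_deriv :: "real \<Rightarrow> real \<Rightarrow> (real \<Rightarrow> real) \<Rightarrow> (real \<Rightarrow> real) \<Rightarrow> bool" where
  "weak_deriv p q u g \<longleftrightarrow>
     (\<forall>c d. p < c \<longrightarrow> d < q \<longrightarrow> set_integrable lborel {c..d} u \<and> set_integrable lborel {c..d} g) \<and>
     (\<forall>\<phi>. test_fun p q \<phi> \<longrightarrow>
        (LINT x:{p<..<q}|lborel. u x * deriv \<phi> x) = - (LINT x:{p<..<q}|lborel. g x * \<phi> x))"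

text \<open>u \<in> H^2_{1/a,0}(0,1), with u1, u2 its first and second weak derivatives;
  u and u1 are the continuous representatives on [0,1].\<close>
definition H2w0 :: "(real \<Rightarrow> real) \<Rightarrow> (real \<Rightarrow> real) \<Rightarrow> (real \<Rightarrow> real) \<Rightarrow> (real \<Rightarrow> real) \<Rightarrow> bool" where
  "H2w0 a u u1 u2 \<longleftrightarrow> continuous_on {0..1} u \<and> continuous_on {0..1} u1 \<and>
     weak_deriv 0 1 u u1 \<and> weak_deriv 0 1 u1 u2 \<and> L2 u2 \<and> L2w a u \<and> u 0 = 0 \<and> u1 0 = 0"

text \<open>u \<in> D(A), with weak derivatives u1..u4; u2, u3 are the continuous representatives on (0,1]
  (they are continuous there since a u4 \<in> L^2_{1/a} and a > 0 on (0,1]).\<close>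
definition DA :: "(real \<Rightarrow> real) \<Rightarrow> (real \<Rightarrow> real) \<Rightarrow> (real \<Rightarrow> real) \<Rightarrow> (real \<Rightarrow> real)
                    \<Rightarrow> (real \<Rightarrow> real) \<Rightarrow> (real \<Rightarrow> real) \<Rightarrow> bool" where
  "DA a u u1 u2 u3 u4 \<longleftrightarrow> H2w0 a u u1 u2 \<and> continuous_on {0<..1} u2 \<and> continuous_on {0<..1} u3 \<and>
     weak_deriv 0 1 u2 u3 \<and> weak_deriv 0 1 u3 u4 \<and> L2w a (\<lambda>x. a x * u4 x)"

definition distH2 :: "(real \<Rightarrow> real) \<Rightarrow> (real \<Rightarrow> real) \<Rightarrow> (real \<Rightarrow> real) \<Rightarrow> (real \<Rightarrow> real) \<Rightarrow> (real \<Rightarrow> real) \<Rightarrow> real" where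
  "distH2 a u u2 v v2 = nrm2w a (\<lambda>x. u x - v x) + nrm2 (\<lambda>x. u2 x - v2 x)"

definition distDA :: "(real \<Rightarrow> real) \<Rightarrow> (real \<Rightarrow> real) \<Rightarrow> (real \<Rightarrow> real) \<Rightarrow> (real \<Rightarrow> real)
     \<Rightarrow> (real \<Rightarrow> real) \<Rightarrow> (real \<Rightarrow> real) \<Rightarrow> (real \<Rightarrow> real) \<Rightarrow> real" where
  "distDA a u u2 u4 v v2 v4 = distH2 a u u2 v v2 + nrm2w a (\<lambda>x. a x * (u4 x - v4 x))"

text \<open>y t x = y(t,x); yx, yxx, yxxx, yxxxx are its spatial (weak) derivatives, yt, ytt its time
  derivatives (in the respective function-space norms), ytx, ytxx the spatial derivatives of yt.\<close>
definition classical_solution ::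
  "(real \<Rightarrow> real) \<Rightarrow> real \<Rightarrow> real \<Rightarrow>
   (real \<Rightarrow> real \<Rightarrow> real) \<Rightarrow> (real \<Rightarrow> real \<Rightarrow> real) \<Rightarrow> (real \<Rightarrow> real \<Rightarrow> real) \<Rightarrow>
   (real \<Rightarrow> real \<Rightarrow> real) \<Rightarrow> (real \<Rightarrow> real \<Rightarrow> real) \<Rightarrow>
   (real \<Rightarrow> real \<Rightarrow> real) \<Rightarrow> (real \<Rightarrow> real \<Rightarrow> real) \<Rightarrow> (real \<Rightarrow> real \<Rightarrow> real) \<Rightarrow>
   (real \<Rightarrow> real \<Rightarrow> real) \<Rightarrow> bool" where
  "classical_solution a \<beta> \<gamma> y yx yxx yxxx yxxxx yt ytx ytxx ytt \<longleftrightarrow>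
    (\<forall>t\<ge>0.
       \<comment> \<open>spatial regularity\<close>
       DA a (y t) (yx t) (yxx t) (yxxx t) (yxxxx t) \<and>
       H2w0 a (yt t) (ytx t) (ytxx t) \<and>
       L2w a (ytt t) \<and>
       \<comment> \<open>y \<in> C([0,\<infinity>); D(A))\<close>
       ((\<lambda>s. distDA a (y s) (yxx s) (yxxxx s) (y t) (yxx t) (yxxxx t)) \<longlongrightarrow> 0) (at t within {0..}) \<and>
       \<comment> \<open>y \<in> C^1([0,\<infinity>); H^2_{1/a,0}), with derivative yt\<close>
       ((\<lambda>h. distH2 a (\<lambda>x. (y (t + h) x - y t x) / h) (\<lambda>x. (yxx (t + h) x - yxx t x) / h)
                       (yt t) (ytxx t)) \<longlongrightarrow> 0) (at 0 within {-t..}) \<and>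
       ((\<lambda>s. distH2 a (yt s) (ytxx s) (yt t) (ytxx t)) \<longlongrightarrow> 0) (at t within {0..}) \<and>
       \<comment> \<open>y \<in> C^2([0,\<infinity>); L^2_{1/a}), with second derivative ytt\<close>
       ((\<lambda>h. nrm2w a (\<lambda>x. (yt (t + h) x - yt t x) / h - ytt t x)) \<longlongrightarrow> 0) (at 0 within {-t..}) \<and>
       ((\<lambda>s. nrm2w a (\<lambda>x. ytt s x - ytt t x)) \<longlongrightarrow> 0) (at t within {0..}) \<and>
       \<comment> \<open>the equation (in L^2_{1/a}, i.e. a.e. in x)\<close>
       (AE x in lborel. x \<in> {0<..<1} \<longrightarrow> ytt t x + a x * yxxxx t x = 0) \<and>
       \<comment> \<open>boundary conditions\<close>
       y t 0 = 0 \<and> yx t 0 = 0 \<and>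
       \<beta> * y t 1 - yxxx t 1 + yt t 1 = 0 \<and>
       \<gamma> * yx t 1 + yxx t 1 + ytx t 1 = 0)"

definition energy ::
  "(real \<Rightarrow> real) \<Rightarrow> real \<Rightarrow> real \<Rightarrow> (real \<Rightarrow> real \<Rightarrow> real) \<Rightarrow> (real \<Rightarrow> real \<Rightarrow> real) \<Rightarrow>
   (real \<Rightarrow> real \<Rightarrow> real) \<Rightarrow> (real \<Rightarrow> real \<Rightarrow> real) \<Rightarrow> real \<Rightarrow> real" where
  "energy a \<beta> \<gamma> y yx yxx yt t =
     1/2 * (LINT x:{0<..<1}|lborel. (yt t x)\<^sup>2 / a x + (yxx t x)\<^sup>2)
     + \<beta>/2 * (y t 1)\<^sup>2 + \<gamma>/2 * (yx t 1)\<^sup>2"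

end

(* Differentiating the energy in time gives the pairings of y_t with y_tt in the weighted space and
   of y_xx with y_txx, plus the derivatives of the boundary terms; the traces at x = 1 are
   differentiable because |u(1)| and |u'(1)| are bounded by the L^2 norm of u''. After inserting
   the equation, two integrations by parts on [d,1] leave v u''' - v' u'' at the endpoints (with
   u = y(t), v = y_t(t)), and the boundary conditions turn the part at x = 1 into the claimed value.

   The part at d vanishes as d -> 0 because K < 2: then a(x)/x^2 is nonincreasing, so
   a(x) >= a(1) x^2 and x u'''' lies in L^2. Hence u''' = O(x^(-1/2)) and u'' is bounded near 0,
   whereas v = O(x^(3/2)) and v' = O(x^(1/2)). *)
theory Submission
  imports Defs
begin

section \<open>Smooth step functions\<close>

text \<open>The derivatives of a classical solution are weak in x and are limits in norm in t, so
  both must be converted before boundary values can be handled. In x, testing against smooth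
  cut-offs gives the fundamental theorem of calculus for a weak derivative and hence absolute
  continuity; this is what the explicit construction of infinitely differentiable steps is for. For
  v and v' absolute continuity reaches down to 0. For u'' and u''' it is available on [d,1] with d >
  0, because these are continuous on (0,1] and it is x u'''', not u'''', that is square integrable.
  Still u'''' v is integrable on all of (0,1), being the product of sqrt(a) u'''' and v / sqrt(a),
  so the integrals over [d,1] converge as d -> 0.

  In t, a squared norm is differentiated by expanding its difference quotient. Dividing by sqrt(a)
  turns the weighted norm into an ordinary one, so one lemma serves both integrals in the energy.
  All limits in t are taken within [0,\<infinity>), hence one-sided at t = 0.\<close>

definition flat :: "nat \<Rightarrow> real \<Rightarrow> real" where
  "flat n x = (if x > 0 then (1 / x) ^ n * exp (- (1 / x)) else 0)"

text \<open>Since \<open>flat n 0 = 0\<close>, this is the difference quotient at the critical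
  point. For x > 0 the substitution x = 1/y turns it into y^(n+1) / exp y; for x < 0 it is
  0.\<close>

lemma flat_div_tendsto_0: "((\<lambda>x. flat n x / x) \<longlongrightarrow> 0) (at 0)"
proof -
  have "((\<lambda>y::real. y ^ Suc n / exp y) \<longlongrightarrow> 0) at_top"
    by (rule tendsto_power_div_exp_0)
  hence "((\<lambda>x::real. inverse x ^ Suc n / exp (inverse x)) \<longlongrightarrow> 0) (at_right 0)"
    by (rule filterlim_compose) (rule filterlim_inverse_at_top_right)
  moreover have "eventually (\<lambda>x. inverse x ^ Suc n / exp (inverse x) = flat n x / x) (at_right 0)"
    using eventually_at_right_less[of 0]
    by eventually_elim (auto simp: flat_def field_simps exp_minus)
  ultimately have "((\<lambda>x. flat n x / x) \<longlongrightarrow> 0) (at_right 0)"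
    by (simp cong: filterlim_cong)
  moreover have "((\<lambda>x. flat n x / x) \<longlongrightarrow> 0) (at_left 0)"
    by (rule tendsto_eventually, rule eventually_at_leftI[of "-1"]) (auto simp: flat_def)
  ultimately show ?thesis
    by (simp add: filterlim_at_split)
qed

text \<open>The product rule raises the power of 1/x by one and by two, so letting the power n vary
  makes these functions closed under differentiation, even across 0.\<close>

lemma flat_has_derivative:
  "(flat n has_real_derivative - real n * flat (n + 1) x + flat (n + 2) x) (at x)"
proof (cases x "0 :: real" rule: linorder_cases)
  case less
  have "(flat n has_real_derivative 0) (at x)"
    by (rule has_field_derivative_transform_within_open[of "\<lambda>_. 0" _ _ "{..<0}"])
       (use less in \<open>auto simp: flat_def\<close>)
  then show ?thesis using less by (simp add: flat_def)
next
  case equal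
  show ?thesis unfolding equal
    using flat_div_tendsto_0[of n] by (simp add: has_field_derivative_iff flat_def)
next
  case greater
  \<comment> \<open>Differentiating the power produces the truncated exponent \<open>n - 1\<close>;
    for n = 0 the factor \<open>real n\<close> removes that term, hence the case split.\<close>
  have eq: "real n * (- (y ^ 2) * y ^ (n - 1)) * e + e * y ^ 2 * y ^ n
      = - real n * (y ^ (n + 1) * e) + y ^ (n + 2) * e" for y e :: real
    by (cases n) (auto simp: algebra_simps power2_eq_square)
  have inv: "((\<lambda>x. 1 / x) has_real_derivative - ((1 / x) ^ 2)) (at x)"
    using greater by (auto intro!: derivative_eq_intros simp: power2_eq_square)
  have "((\<lambda>x. (1 / x) ^ n * exp (- (1 / x))) has_real_derivative
      real n * (- ((1 / x) ^ 2) * (1 / x) ^ (n - 1)) * exp (- (1 / x))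
      + exp (- (1 / x)) * (1 / x) ^ 2 * (1 / x) ^ n) (at x)"
    by (rule DERIV_cong[OF DERIV_mult[OF DERIV_power[OF inv] DERIV_fun_exp[OF DERIV_minus[OF inv]]]])
       simp
  then have *: "((\<lambda>x. (1 / x) ^ n * exp (- (1 / x))) has_real_derivative
      - real n * flat (n + 1) x + flat (n + 2) x) (at x)"
    unfolding eq using greater by (simp add: flat_def)
  show ?thesis
    by (rule has_field_derivative_transform_within_open[OF *, of "{0<..}"])
       (use greater in \<open>auto simp: flat_def\<close>)
qed

text \<open>Every member has its derivative in the family again, hence is infinitely differentiable;
  this avoids computing the iterated derivatives of the cut-off functions.\<close>
inductive_set smooth_family :: "(real \<Rightarrow> real) set" where
  const: "(\<lambda>_. c) \<in> smooth_family"
| flat: "(\<lambda>x. flat n (r * x + s)) \<in> smooth_family"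
| add: "f \<in> smooth_family \<Longrightarrow> g \<in> smooth_family \<Longrightarrow> (\<lambda>x. f x + g x) \<in> smooth_family"
| mult: "f \<in> smooth_family \<Longrightarrow> g \<in> smooth_family \<Longrightarrow> (\<lambda>x. f x * g x) \<in> smooth_family"

lemma smooth_family_has_derivative:
  "f \<in> smooth_family \<Longrightarrow> \<exists>g\<in>smooth_family. \<forall>x. (f has_real_derivative g x) (at x)"
proof (induction rule: smooth_family.induct)
  case (const c)
  show ?case by (rule bexI[of _ "\<lambda>_. 0"]) (auto intro: smooth_family.const)
next
  case (flat n r s)
  have *: "((\<lambda>x. flat n (r * x + s)) has_real_derivative
     r * ((- real n) * flat (n + 1) (r * x + s) + flat (n + 2) (r * x + s))) (at x)" for x
    by (rule DERIV_cong[OF DERIV_chain2[OF flat_has_derivative]])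
       (auto intro!: derivative_eq_intros)
  have "(\<lambda>x. r * ((- real n) * flat (n + 1) (r * x + s) + flat (n + 2) (r * x + s)))
      \<in> smooth_family"
    by (intro smooth_family.intros)
  then show ?case by (rule bexI[rotated]) (rule allI, rule *)
next
  case (add f g)
  then obtain f' g' where "f' \<in> smooth_family" "g' \<in> smooth_family"
    and "\<And>x. (f has_real_derivative f' x) (at x)" "\<And>x. (g has_real_derivative g' x) (at x)"
    by blast
  then show ?case
    by (intro bexI[of _ "\<lambda>x. f' x + g' x"]) (auto intro!: derivative_eq_intros smooth_family.intros)
next
  case (mult f g)
  then obtain f' g' where "f' \<in> smooth_family" "g' \<in> smooth_family"
    and "\<And>x. (f has_real_derivative f' x) (at x)" "\<And>x. (g has_real_derivative g' x) (at x)"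
    by blast
  with mult show ?case
    by (intro bexI[of _ "\<lambda>x. f' x * g x + g' x * f x"])
       (auto intro!: derivative_eq_intros smooth_family.intros)
qed

lemma smooth_family_funpow_deriv: "f \<in> smooth_family \<Longrightarrow> (deriv ^^ k) f \<in> smooth_family"
proof (induction k)
  case (Suc k)
  then obtain g where "g \<in> smooth_family" "\<And>x. ((deriv ^^ k) f has_real_derivative g x) (at x)"
    using smooth_family_has_derivative by blast
  then show ?case by (metis DERIV_imp_deriv ext funpow.simps(2) o_apply)
qed auto

lemma smooth_family_continuous_on: "f \<in> smooth_family \<Longrightarrow> continuous_on A f"
  using smooth_family_has_derivative DERIV_isCont continuous_at_imp_continuous_on by metis

text \<open>Membership is asked of the derivative because a smooth step is obtained as an
  antiderivative of a member, not by the rules of \<open>smooth_family\<close>.\<close>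

lemma test_funI:
  assumes deriv: "\<And>x. (\<phi> has_real_derivative \<psi> x) (at x)" and "\<psi> \<in> smooth_family"
    and supp: "p < c" "c \<le> d" "d < q" "\<And>x. x \<notin> {c..d} \<Longrightarrow> \<phi> x = 0"
  shows "test_fun p q \<phi>"
proof -
  have "deriv \<phi> = \<psi>"
    using deriv by (auto intro: DERIV_imp_deriv)
  then have "((deriv ^^ k) \<phi>) differentiable (at x)" for k x
  proof (cases k)
    case 0
    then show ?thesis using deriv by (auto simp: real_differentiable_def)
  next
    case (Suc j)
    then show ?thesis
      using smooth_family_has_derivative[OF smooth_family_funpow_deriv[OF assms(2), of j]] \<open>deriv \<phi> = \<psi>\<close>
      by (auto simp: funpow_Suc_right real_differentiable_def simp del: funpow.simps)
  qed
  then show ?thesis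
    unfolding test_fun_def using supp by blast
qed

text \<open>The derivative is carried along because a weak derivative pairs u with
  \<open>\<eta>\<close>, where it acts as an averaging kernel near c, and g with \<open>S\<close>,
  where it acts as a cut-off.\<close>

definition smooth_step :: "real \<Rightarrow> real \<Rightarrow> (real \<Rightarrow> real) \<Rightarrow> (real \<Rightarrow> real) \<Rightarrow> bool" where
  "smooth_step c d S \<eta> \<longleftrightarrow> \<eta> \<in> smooth_family \<and>
     (\<forall>x. (S has_real_derivative \<eta> x) (at x) \<and> \<eta> x \<ge> 0 \<and> (x \<notin> {c..d} \<longrightarrow> \<eta> x = 0) \<and>
        (x \<le> c \<longrightarrow> S x = 0) \<and> (x \<ge> d \<longrightarrow> S x = 1) \<and> 0 \<le> S x \<and> S x \<le> 1)"

lemma smooth_step_exists: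
  assumes "c < d"
  obtains S \<eta> where "smooth_step c d S \<eta>"
proof -
  \<comment> \<open>On (c,d) this is the classical bump exp(-1/(x-c)) exp(-1/(d-x)); the arguments
    are written in the affine form required by the rule \<open>flat\<close> of
    \<open>smooth_family\<close>.\<close>
  define b where "b = (\<lambda>x. flat 0 (1 * x + (- c)) * flat 0 ((-1) * x + d))"
  have b: "b \<in> smooth_family"
    unfolding b_def by (intro smooth_family.intros)
  have b_nonneg: "b x \<ge> 0" for x by (auto simp: b_def flat_def)
  have b_pos: "b x > 0" if "c < x" "x < d" for x using that by (auto simp: b_def flat_def)
  have b_zero: "b x = 0" if "x \<notin> {c<..<d}" for x using that by (auto simp: b_def flat_def)
  have "\<exists>F. \<forall>x. (F has_vector_derivative b x) (at x)"
    using einterval_antiderivative[of "-\<infinity>" "\<infinity>" b] smooth_family_continuous_on[OF b, of UNIV]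
    by (auto simp: continuous_on_eq_continuous_at)
  then obtain F where F: "\<And>x. (F has_real_derivative b x) (at x)"
    by (auto simp: has_real_derivative_iff_has_vector_derivative)
  have cont: "continuous_on A F" for A
    using F DERIV_isCont continuous_at_imp_continuous_on by metis
  have mono: "F x \<le> F y" if "x \<le> y" for x y
    by (rule DERIV_nonneg_imp_nondecreasing[OF that]) (use F b_nonneg in blast)
  have left: "F x = F c" if "x \<le> c" for x
  proof (cases "x = c")
    case False
    then show ?thesis
      using that by (intro DERIV_isconst_end[of x c F, symmetric] cont)
        (auto, metis F b_zero greaterThanLessThan_iff less_asym)
  qed auto
  have right: "F x = F d" if "x \<ge> d" for x
  proof (cases "x = d")
    case False
    then show ?thesis
      using that by (intro DERIV_isconst_end[of d x F] cont)
        (auto, metis F b_zero greaterThanLessThan_iff less_asym)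
  qed auto
  have less: "F c < F d"
    by (rule DERIV_pos_imp_increasing_open[OF assms]) (use F b_pos cont in blast)+
  \<comment> \<open>Normalisation: the antiderivative is constant on either side of [c,d], and
    \<open>m\<close> scales its total increase to 1.\<close>
  define m where "m = 1 / (F d - F c)"
  have m: "m > 0" using less by (simp add: m_def)
  have "smooth_step c d (\<lambda>x. m * (F x - F c)) (\<lambda>x. m * b x)"
    unfolding smooth_step_def
  proof (intro conjI allI impI)
    show "(\<lambda>x. m * b x) \<in> smooth_family" using b by (intro smooth_family.intros)
    show "((\<lambda>x. m * (F x - F c)) has_real_derivative m * b x) (at x)" for x
      using F by (auto intro!: derivative_eq_intros)
    show "m * b x \<ge> 0" for x using m b_nonneg by simp
    show "m * b x = 0" if "x \<notin> {c..d}" for x using that b_zero[of x] by auto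
    show "m * (F x - F c) = 0" if "x \<le> c" for x using left[OF that] by simp
    show "m * (F x - F c) = 1" if "x \<ge> d" for x using right[OF that] less by (simp add: m_def)
    show "0 \<le> m * (F x - F c)" for x
    proof -
      have "F c \<le> F x" using mono[of c x] left[of x] by linarith
      then show ?thesis using m by simp
    qed
    show "m * (F x - F c) \<le> 1" for x
    proof -
      have "F x \<le> F d" using mono[of x d] right[of x] by linarith
      then show ?thesis using less by (simp add: m_def)
    qed
  qed
  then show ?thesis by (rule that)
qed

section \<open>Weak derivatives and absolutely continuous functions\<close>

lemma smooth_step_integral:
  assumes "smooth_step c d S \<eta>" "c \<le> d"
  shows "(LINT z:{c..d}|lborel. \<eta> z) = 1"
proof -
  have "(LINT z:{c..d}|lborel. \<eta> z) = S d - S c"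
    unfolding set_lebesgue_integral_def
  proof (rule integral_FTC_atLeastAtMost[OF assms(2)])
    show "continuous_on {c..d} \<eta>"
      using assms by (auto simp: smooth_step_def intro: smooth_family_continuous_on)
    show "(S has_vector_derivative \<eta> x) (at x within {c..d})" for x
      using assms unfolding smooth_step_def has_real_derivative_iff_has_vector_derivative[symmetric]
      by (blast intro: has_field_derivative_at_within)
  qed
  then show ?thesis using assms by (simp add: smooth_step_def)
qed

lemma set_integrable_mult_vanishing:
  fixes f h :: "real \<Rightarrow> real"
  assumes "continuous_on {c..d} f" "continuous_on {c..d} h" "\<And>z. z \<notin> {c..d} \<Longrightarrow> h z = 0" "{c..d} \<subseteq> A"
  shows "set_integrable lborel A (\<lambda>z. f z * h z)"
    and "(LINT z:A|lborel. f z * h z) = (LINT z:{c..d}|lborel. f z * h z)"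
proof -
  have eq: "(\<lambda>z. indicator A z *\<^sub>R (f z * h z)) = (\<lambda>z. indicator {c..d} z *\<^sub>R (f z * h z))"
    using assms(3,4) by (auto simp: indicator_def fun_eq_iff)
  have "set_integrable lborel {c..d} (\<lambda>z. f z * h z)"
    by (intro borel_integrable_atLeastAtMost' continuous_on_mult assms)
  then show "set_integrable lborel A (\<lambda>z. f z * h z)"
    by (simp only: set_integrable_def eq)
  show "(LINT z:A|lborel. f z * h z) = (LINT z:{c..d}|lborel. f z * h z)"
    by (simp only: set_lebesgue_integral_def eq)
qed

text \<open>The bumps are nonnegative, have mass 1 and live on \<open>{x..x + e n}\<close>, so each
  pairing is a weighted mean of u over an interval shrinking to x from the right. Only continuity of
  u on that side enters.\<close>

lemma smooth_step_average_tendsto: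
  assumes u: "continuous_on {x..x + r} u" and e: "e \<longlonglongrightarrow> 0" "\<And>n. 0 < e n" "\<And>n. e n \<le> r"
    and step: "\<And>n. smooth_step x (x + e n) (S n) (\<eta> n)"
    and A: "{x..x + r} \<subseteq> A"
  shows "(\<lambda>n. LINT z:A|lborel. u z * \<eta> n z) \<longlonglongrightarrow> u x"
proof (rule LIMSEQ_I)
  fix \<epsilon> :: real assume \<epsilon>: "\<epsilon> > 0"
  have "r > 0" using e(2,3)[of 0] by simp
  then obtain \<delta> where \<delta>: "\<delta> > 0" "\<And>z. z \<in> {x..x + r} \<Longrightarrow> dist z x < \<delta> \<Longrightarrow> dist (u z) (u x) < \<epsilon> / 2"
    using u \<epsilon> unfolding continuous_on_iff
    by (metis atLeastAtMost_iff half_gt_zero le_add_same_cancel1 less_imp_le order_refl)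
  obtain N where N: "\<And>n. n \<ge> N \<Longrightarrow> e n < \<delta>"
    using order_tendstoD(2)[OF e(1) \<delta>(1)] by (auto simp: eventually_sequentially)
  show "\<exists>N. \<forall>n\<ge>N. norm ((LINT z:A|lborel. u z * \<eta> n z) - u x) < \<epsilon>"
  proof (intro exI allI impI)
    fix n assume n: "n \<ge> N"
    let ?I = "{x..x + e n}"
    have sub: "?I \<subseteq> {x..x + r}" using e(3)[of n] by auto
    have \<eta>: "continuous_on ?I (\<eta> n)" "\<And>z. \<eta> n z \<ge> 0" "\<And>z. z \<notin> ?I \<Longrightarrow> \<eta> n z = 0"
      using step[of n] by (auto simp: smooth_step_def intro: smooth_family_continuous_on)
    have uI: "continuous_on ?I u" by (rule continuous_on_subset[OF u sub])
    have one: "(LINT z:?I|lborel. \<eta> n z) = 1"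
      using smooth_step_integral[OF step] e(2)[of n] by simp
    have int: "set_integrable lborel ?I (\<lambda>z. u z * \<eta> n z)" "set_integrable lborel ?I (\<eta> n)"
      by (intro borel_integrable_atLeastAtMost' continuous_on_mult uI \<eta>)+
    have A': "(LINT z:A|lborel. u z * \<eta> n z) = (LINT z:?I|lborel. u z * \<eta> n z)"
      using uI \<eta>(1,3) by (rule set_integrable_mult_vanishing) (use sub A in auto)
    have close: "\<bar>u z - u x\<bar> \<le> \<epsilon> / 2" if "z \<in> ?I" for z
      using \<delta>(2)[of z] that sub N[OF n] by (force simp: dist_real_def)
    have "(LINT z:?I|lborel. u z * \<eta> n z) \<le> (LINT z:?I|lborel. (u x + \<epsilon> / 2) * \<eta> n z)"
    proof (rule set_integral_mono)
      show "u z * \<eta> n z \<le> (u x + \<epsilon> / 2) * \<eta> n z" if "z \<in> ?I" for z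
        using close[OF that] by (intro mult_right_mono \<eta>(2)) linarith
    qed (use int in auto)
    moreover have "(LINT z:?I|lborel. (u x - \<epsilon> / 2) * \<eta> n z) \<le> (LINT z:?I|lborel. u z * \<eta> n z)"
    proof (rule set_integral_mono)
      show "(u x - \<epsilon> / 2) * \<eta> n z \<le> u z * \<eta> n z" if "z \<in> ?I" for z
        using close[OF that] by (intro mult_right_mono \<eta>(2)) linarith
    qed (use int in auto)
    ultimately show "norm ((LINT z:A|lborel. u z * \<eta> n z) - u x) < \<epsilon>"
      using \<epsilon> by (simp add: A' one abs_less_iff)
  qed
qed

text \<open>The weak derivative is tested with the difference of a smooth step just right of \<open>x\<close> and one
  just right of \<open>y\<close>, the widths of the steps tending to 0.\<close>
lemma weak_deriv_FTC:
  assumes wd: "weak_deriv p q u g" and u: "continuous_on {p<..<q} u"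
    and xy: "p < x" "x < y" "y < q"
  shows "u y - u x = (LINT s:{x..y}|lborel. g s)"
proof -
  \<comment> \<open>\<open>q'\<close> keeps the supports of all test functions away from q. The two
    entries of the minimum below make the step at x end no later than y and the step at y no later
    than \<open>q'\<close>.\<close>
  define q' where "q' = (y + q) / 2"
  define r where "r = min (y - x) (q' - y)"
  define e where "e n = r / real (Suc n)" for n
  have q': "y < q'" "q' < q" using xy by (auto simp: q'_def)
  have r: "r > 0" using xy q' by (simp add: r_def)
  have e: "e \<longlonglongrightarrow> 0" "\<And>n. 0 < e n" "\<And>n. e n \<le> r"
    using r LIMSEQ_Suc[OF lim_const_over_n[of r]] by (auto simp: e_def[abs_def] field_simps)
  have "\<forall>n. \<exists>S \<eta>. smooth_step x (x + e n) S \<eta>" "\<forall>n. \<exists>T \<theta>. smooth_step y (y + e n) T \<theta>"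
    using e(2) by (metis less_add_same_cancel1 smooth_step_exists)+
  then obtain S \<eta> T \<theta> where S: "\<And>n. smooth_step x (x + e n) (S n) (\<eta> n)"
    and T: "\<And>n. smooth_step y (y + e n) (T n) (\<theta> n)"
    by metis
  \<comment> \<open>A plateau rising just right of x and falling just right of y; it converges to
    the indicator of (x,y].\<close>
  define \<phi> where "\<phi> n z = S n z - T n z" for n z
  have \<phi>_deriv: "(\<phi> n has_real_derivative \<eta> n z + (-1) * \<theta> n z) (at z)" for n z
    unfolding \<phi>_def[abs_def] using S[of n] T[of n]
    by (auto simp: smooth_step_def intro!: derivative_eq_intros)
  have \<phi>_supp: "\<phi> n z = 0" if "z \<notin> {x..q'}" for n z
    using that S[of n] T[of n] e(2,3)[of n] xy q' by (auto simp: smooth_step_def \<phi>_def r_def)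
  have \<phi>_bound: "\<bar>\<phi> n z\<bar> \<le> 1" for n z
    using S[of n] T[of n] unfolding smooth_step_def \<phi>_def abs_le_iff by (smt (verit))
  have test: "test_fun p q (\<phi> n)" for n
  proof (rule test_funI[OF \<phi>_deriv])
    show "(\<lambda>z. \<eta> n z + (-1) * \<theta> n z) \<in> smooth_family"
      using S[of n] T[of n] by (intro smooth_family.intros) (auto simp: smooth_step_def)
    show "\<And>z. z \<notin> {x..q'} \<Longrightarrow> \<phi> n z = 0" by (rule \<phi>_supp)
  qed (use xy q' in auto)
  have deriv: "deriv (\<phi> n) z = \<eta> n z + (-1) * \<theta> n z" for n z
    by (rule DERIV_imp_deriv[OF \<phi>_deriv])
  have sub: "{x..x + r} \<subseteq> {p<..<q}" "{y..y + r} \<subseteq> {p<..<q}"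
    using xy q' by (auto simp: r_def)
  have cont: "continuous_on {x..x + r} u" "continuous_on {y..y + r} u"
    using sub u continuous_on_subset by blast+
  let ?A = "{p<..<q}"
  have "(LINT z:?A|lborel. u z * \<eta> n z) - (LINT z:?A|lborel. u z * \<theta> n z)
      = - (LINT z:?A|lborel. g z * \<phi> n z)" for n
  proof -
    have e3: "e n \<le> r" by (rule e)
    have "set_integrable lborel ?A (\<lambda>z. u z * \<eta> n z)"
      by (rule set_integrable_mult_vanishing[OF cont(1)])
         (use S[of n] sub e3 in \<open>auto simp: smooth_step_def intro: smooth_family_continuous_on\<close>)
    moreover have "set_integrable lborel ?A (\<lambda>z. u z * \<theta> n z)"
      by (rule set_integrable_mult_vanishing[OF cont(2)])
         (use T[of n] sub e3 in \<open>auto simp: smooth_step_def intro: smooth_family_continuous_on\<close>)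
    ultimately have "(LINT z:?A|lborel. u z * \<eta> n z) - (LINT z:?A|lborel. u z * \<theta> n z)
        = (LINT z:?A|lborel. u z * deriv (\<phi> n) z)"
      by (simp add: deriv algebra_simps)
    also have "\<dots> = - (LINT z:?A|lborel. g z * \<phi> n z)"
      using wd test by (auto simp: weak_deriv_def)
    finally show ?thesis .
  qed
  moreover have "(\<lambda>n. LINT z:?A|lborel. u z * \<eta> n z) \<longlonglongrightarrow> u x"
    by (rule smooth_step_average_tendsto[OF cont(1) e S sub(1)])
  moreover have "(\<lambda>n. LINT z:?A|lborel. u z * \<theta> n z) \<longlonglongrightarrow> u y"
    by (rule smooth_step_average_tendsto[OF cont(2) e T sub(2)])
  ultimately have lim1: "(\<lambda>n. - (LINT z:?A|lborel. g z * \<phi> n z)) \<longlonglongrightarrow> u x - u y"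
    using tendsto_diff by fastforce
  have g: "set_integrable lborel {x..q'} g"
    using wd xy q' by (auto simp: weak_deriv_def)
  then have gm: "(\<lambda>z. indicator {x..q'} z * g z) \<in> borel_measurable lborel"
    by (auto simp: set_integrable_def dest: borel_measurable_integrable)
  have "(\<lambda>n. LINT z:?A|lborel. g z * \<phi> n z) \<longlonglongrightarrow> (LINT s:{x..y}|lborel. g s)"
    unfolding set_lebesgue_integral_def
  proof (rule integral_dominated_convergence[where w = "\<lambda>z. \<bar>indicator {x..q'} z * g z\<bar>"])
    \<comment> \<open>Measurability of g is known after restriction to a compact subinterval of
      (p,q), so the integrands are rewritten with the factor for \<open>{x..q'}\<close>.\<close>
    have "(\<lambda>z. indicator {x..y} z * (indicator {x..q'} z * g z)) \<in> borel_measurable lborel"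
      using gm by measurable
    also have "(\<lambda>z. indicator {x..y} z * (indicator {x..q'} z * g z)) = (\<lambda>z. indicator {x..y} z *\<^sub>R g z)"
      using q' by (auto simp: indicator_def fun_eq_iff)
    finally show "(\<lambda>z. indicator {x..y} z *\<^sub>R g z) \<in> borel_measurable lborel" .
    show "integrable lborel (\<lambda>z. \<bar>indicator {x..q'} z * g z\<bar>)"
      using g by (auto simp: set_integrable_def)
    have eq: "indicator ?A z *\<^sub>R (g z * \<phi> n z) = (indicator {x..q'} z * g z) * \<phi> n z" for n z
      using \<phi>_supp[of z n] xy q' by (auto simp: indicator_def)
    have "continuous_on UNIV (\<phi> n)" for n
      using \<phi>_deriv DERIV_isCont continuous_at_imp_continuous_on by metis
    then have "\<phi> n \<in> borel_measurable lborel" for n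
      by (simp add: borel_measurable_continuous_onI)
    then show "(\<lambda>z. indicator ?A z *\<^sub>R (g z * \<phi> n z)) \<in> borel_measurable lborel" for n
      unfolding eq using gm by measurable
    show "AE z in lborel. norm (indicator ?A z *\<^sub>R (g z * \<phi> n z)) \<le> \<bar>indicator {x..q'} z * g z\<bar>" for n
      unfolding eq real_norm_def abs_mult[of _ "\<phi> n _"]
      by (intro always_eventually allI mult_left_le \<phi>_bound abs_ge_zero)
    \<comment> \<open>The exceptional point is z = x: every \<open>\<phi> n\<close> is 0 there,
      while the indicator of \<open>{x..y}\<close> is 1.\<close>
    show "AE z in lborel. (\<lambda>n. indicator ?A z *\<^sub>R (g z * \<phi> n z)) \<longlonglongrightarrow> indicator {x..y} z *\<^sub>R g z"
      using AE_lborel_singleton[of x]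
    proof eventually_elim
      case (elim z)
      have "eventually (\<lambda>n. \<phi> n z = indicator {x..y} z) sequentially"
      proof (cases "z < x")
        case True
        then have "\<phi> n z = 0" for n using \<phi>_supp by auto
        with True show ?thesis by auto
      next
        case False
        have "eventually (\<lambda>n. e n < z - x) sequentially"
          using False elim by (intro order_tendstoD[OF e(1)]) auto
        moreover have "eventually (\<lambda>n. z > y \<longrightarrow> e n < z - y) sequentially"
          using order_tendstoD(2)[OF e(1), of "z - y"] by (cases "z > y") auto
        ultimately show ?thesis
        proof eventually_elim
          case (elim n)
          have "S n z = 1" using elim S[of n] by (auto simp: smooth_step_def)
          moreover have "T n z = (if z \<le> y then 0 else 1)"
            using elim T[of n] by (auto simp: smooth_step_def)
          ultimately show ?case using False by (auto simp: \<phi>_def)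
        qed
      qed
      then have "eventually (\<lambda>n. indicator ?A z *\<^sub>R (g z * \<phi> n z) = indicator {x..y} z *\<^sub>R g z) sequentially"
        by eventually_elim (use xy in \<open>auto simp: indicator_def\<close>)
      then show ?case by (rule tendsto_eventually)
    qed
  qed
  then have "(\<lambda>n. - (LINT z:?A|lborel. g z * \<phi> n z)) \<longlonglongrightarrow> - (LINT s:{x..y}|lborel. g s)"
    by (rule tendsto_minus)
  from LIMSEQ_unique[OF this lim1] show ?thesis by simp
qed

text \<open>Absolute continuity of u on [c,d] with density g, encoded by the integral formula so
  that almost-everywhere differentiation is never invoked.\<close>

definition primitive_on :: "real \<Rightarrow> real \<Rightarrow> (real \<Rightarrow> real) \<Rightarrow> (real \<Rightarrow> real) \<Rightarrow> bool" where
  "primitive_on c d u g \<longleftrightarrow> set_integrable lborel {c..d} g \<and>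
     (\<forall>x\<in>{c..d}. u x = u c + (LINT s:{c..x}|lborel. g s))"

lemma set_integral_split_Icc:
  fixes f :: "real \<Rightarrow> real"
  assumes "set_integrable lborel {a..c} f" "a \<le> b" "b \<le> c"
  shows "(LINT s:{a..c}|lborel. f s) = (LINT s:{a..b}|lborel. f s) + (LINT s:{b..c}|lborel. f s)"
proof -
  have "set_integrable lborel {a..b} f" "set_integrable lborel {b..c} f"
    by (rule set_integrable_subset[OF assms(1)]; use assms in auto)+
  then show ?thesis
    using Henstock_Kurzweil_Integration.integral_combine[OF assms(2,3), of f] assms(1)
    by (simp add: set_borel_integral_eq_integral)
qed

lemma continuous_on_indefinite_set_integral:
  fixes g :: "real \<Rightarrow> real"
  assumes "set_integrable lborel {c..d} g"
  shows "continuous_on {c..d} (\<lambda>x. LINT s:{c..x}|lborel. g s)"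
proof -
  have "continuous_on {c..d} (\<lambda>x. integral {c..x} g)"
    using assms by (intro indefinite_integral_continuous_1 set_borel_integral_eq_integral)
  moreover have "integral {c..x} g = (LINT s:{c..x}|lborel. g s)" if "x \<in> {c..d}" for x
    by (rule set_borel_integral_eq_integral(2)[symmetric], rule set_integrable_subset[OF assms])
       (use that in auto)
  ultimately show ?thesis by (rule continuous_on_eq)
qed

lemma primitive_on_continuous_on:
  assumes "primitive_on c d u g"
  shows "continuous_on {c..d} u"
proof -
  have "continuous_on {c..d} (\<lambda>x. u c + (LINT s:{c..x}|lborel. g s))"
    using assms by (intro continuous_intros continuous_on_indefinite_set_integral) (simp add: primitive_on_def)
  then show ?thesis
    by (rule continuous_on_eq) (metis assms primitive_on_def)
qed

lemma primitive_on_diff: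
  assumes "primitive_on c d u g" "c \<le> x" "x \<le> y" "y \<le> d"
  shows "u y - u x = (LINT s:{x..y}|lborel. g s)"
proof -
  have "set_integrable lborel {c..y} g"
    by (rule set_integrable_subset[of _ "{c..d}"]) (use assms in \<open>auto simp: primitive_on_def\<close>)
  note split = set_integral_split_Icc[OF this assms(2,3)]
  have "u z = u c + (LINT s:{c..z}|lborel. g s)" if "z \<in> {c..d}" for z
    using assms(1) that unfolding primitive_on_def by blast
  from this[of x] this[of y] split show ?thesis
    using assms(2-4) by auto
qed

lemma primitive_on_subset:
  assumes "primitive_on c d u g" "c \<le> c'" "d' \<le> d"
  shows "primitive_on c' d' u g"
  unfolding primitive_on_def
proof (intro conjI ballI)
  show "set_integrable lborel {c'..d'} g"
    by (rule set_integrable_subset[of _ "{c..d}"]) (use assms in \<open>auto simp: primitive_on_def\<close>)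
  show "u x = u c' + (LINT s:{c'..x}|lborel. g s)" if "x \<in> {c'..d'}" for x
    using primitive_on_diff[OF assms(1), of c' x] that assms by (simp add: algebra_simps)
qed

text \<open>A weak derivative gives information strictly inside (p,q), but c = p and d = q are
  allowed here. On the open interval u minus the integral of g is constant; continuity up to c and
  d, with g integrable there, carries the constant to the endpoints.\<close>

lemma weak_deriv_primitive_on:
  assumes wd: "weak_deriv p q u g" and cd: "p \<le> c" "c < d" "d \<le> q"
    and u: "continuous_on {p<..<q} u" "continuous_on {c..d} u"
    and g: "set_integrable lborel {c..d} g"
  shows "primitive_on c d u g"
  unfolding primitive_on_def
proof (intro conjI ballI)
  let ?H = "\<lambda>x. u x - (LINT s:{c..x}|lborel. g s)"
  define m where "m = (c + d) / 2"
  have m: "c < m" "m < d" using cd by (auto simp: m_def)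
  have eq: "?H x = ?H m" if "x \<in> {c<..<d}" for x
  proof -
    have *: "?H z = ?H w" if "c < w" "w \<le> z" "z < d" for w z
    proof (cases "w = z")
      case False
      have "set_integrable lborel {c..z} g"
        by (rule set_integrable_subset[OF g]) (use that in auto)
      then have "(LINT s:{c..z}|lborel. g s) = (LINT s:{c..w}|lborel. g s) + (LINT s:{w..z}|lborel. g s)"
        by (rule set_integral_split_Icc) (use that in auto)
      moreover have "u z - u w = (LINT s:{w..z}|lborel. g s)"
        by (rule weak_deriv_FTC[OF wd u(1)]) (use that cd False in auto)
      ultimately show ?thesis by linarith
    qed auto
    show ?thesis
    proof (cases "x \<le> m")
      case True
      show ?thesis by (rule *[symmetric]) (use True that m in auto)
    next
      case False
      show ?thesis by (rule *) (use False that m in auto)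
    qed
  qed
  have cont: "continuous_on {c..d} ?H"
    by (intro continuous_intros u(2) continuous_on_indefinite_set_integral g)
  have const: "?H x = ?H m" if "x \<in> {c..d}" for x
  proof (rule continuous_constant_on_closure[of "{c<..<d}" ?H])
    show "?H z = ?H m" if "z \<in> {c<..<d}" for z by (rule eq[OF that])
  qed (use cont that cd in auto)
  fix x assume x: "x \<in> {c..d}"
  \<comment> \<open>Splitting the one-point interval at its point gives I = I + I, so the integral
    over it is 0.\<close>
  have "set_integrable lborel {c..c} g"
    by (rule set_integrable_subset[OF g]) (use cd in auto)
  from set_integral_split_Icc[OF this order_refl order_refl] have "(LINT s:{c..c}|lborel. g s) = 0"
    by linarith
  moreover have "?H x = ?H c"
    using const[OF x] const[of c] cd by fastforce
  ultimately show "u x = u c + (LINT s:{c..x}|lborel. g s)"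
    by linarith
qed (rule g)

lemma set_integrable_mult_continuous_on:
  fixes f h :: "real \<Rightarrow> real"
  assumes f: "set_integrable lborel {c..d} f" and h: "continuous_on {c..d} h"
  shows "set_integrable lborel {c..d} (\<lambda>x. f x * h x)"
proof -
  have "bounded (h ` {c..d})"
    by (intro compact_imp_bounded compact_continuous_image h compact_Icc)
  then obtain B where B: "\<And>x. x \<in> {c..d} \<Longrightarrow> \<bar>h x\<bar> \<le> B"
    unfolding bounded_iff by (metis imageI real_norm_def)
  have "set_borel_measurable lborel {c..d} h"
    using borel_measurable_continuous_on_indicator[OF _ h]
    by (simp add: set_borel_measurable_def)
  then have "(\<lambda>x. (indicator {c..d} x *\<^sub>R f x) * (indicator {c..d} x *\<^sub>R h x)) \<in> borel_measurable lborel"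
    using borel_measurable_integrable[OF f[unfolded set_integrable_def]]
    by (intro borel_measurable_times) (auto simp: set_borel_measurable_def)
  also have "(\<lambda>x. (indicator {c..d} x *\<^sub>R f x) * (indicator {c..d} x *\<^sub>R h x))
      = (\<lambda>x. indicator {c..d} x *\<^sub>R (f x * h x))"
    by (auto simp: indicator_def fun_eq_iff)
  finally have "set_borel_measurable lborel {c..d} (\<lambda>x. f x * h x)"
    by (simp add: set_borel_measurable_def)
  moreover have "set_integrable lborel {c..d} (\<lambda>x. B * f x)"
    using f by simp
  moreover have "norm (f x * h x) \<le> norm (B * f x)" if "x \<in> {c..d}" for x
  proof -
    have "\<bar>h x\<bar> * \<bar>f x\<bar> \<le> \<bar>B\<bar> * \<bar>f x\<bar>"
      using B[OF that] by (intro mult_right_mono) linarith+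
    then show ?thesis by (simp add: abs_mult mult.commute)
  qed
  ultimately show ?thesis
    by (intro set_integrable_bound[of _ _ "\<lambda>x. B * f x" "\<lambda>x. f x * h x"]) auto
qed

text \<open>Fubini for \<open>f s * g x\<close> on the triangle \<open>s \<le> x\<close>.\<close>
lemma primitive_on_integral_by_parts:
  assumes F: "primitive_on c d F f" and G: "primitive_on c d G g" and cd: "c \<le> d"
  shows "(LINT x:{c..d}|lborel. g x * F x) = F d * G d - F c * G c - (LINT x:{c..d}|lborel. f x * G x)"
proof -
  define ff where "ff x = indicator {c..d} x * f x" for x
  define gg where "gg x = indicator {c..d} x * g x" for x
  have f: "set_integrable lborel {c..d} f" and g: "set_integrable lborel {c..d} g"
    using F G by (auto simp: primitive_on_def)
  have ff: "integrable lborel ff" and gg: "integrable lborel gg"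
    using f g by (simp_all add: set_integrable_def ff_def[abs_def] gg_def[abs_def])
  note [measurable] = borel_measurable_integrable[OF ff] borel_measurable_integrable[OF gg]
  \<comment> \<open>The last factor cuts out the triangle; K is dominated by the product of
    \<open>ff\<close> and \<open>gg\<close>, which is integrable on the plane.\<close>
  let ?K = "\<lambda>s x. ff s * gg x * (if s \<le> x then 1 else 0 :: real)"
  have "integrable (lborel \<Otimes>\<^sub>M lborel) (\<lambda>(s, x). ff s * gg x)"
  proof (rule lborel_pair.Fubini_integrable)
    show "integrable lborel (\<lambda>s. LINT x|lborel. norm (case (s, x) of (s, x) \<Rightarrow> ff s * gg x))"
      using ff by (simp add: abs_mult)
    show "AE s in lborel. integrable lborel (\<lambda>x. case (s, x) of (s, x) \<Rightarrow> ff s * gg x)"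
      using gg by simp
  qed measurable
  then have "integrable (lborel \<Otimes>\<^sub>M lborel) (case_prod ?K)"
  proof (rule Bochner_Integration.integrable_bound)
    show "(\<lambda>(s, x). ?K s x) \<in> borel_measurable (lborel \<Otimes>\<^sub>M lborel)" by measurable
  qed auto
  from lborel_pair.Fubini_integral[OF this]
  have Fub: "(LINT x|lborel. (LINT s|lborel. ?K s x)) = (LINT s|lborel. (LINT x|lborel. ?K s x))" .
  have "(LINT s|lborel. ?K s x) = indicator {c..d} x *\<^sub>R (g x * F x - F c * g x)" for x
  proof (cases "x \<in> {c..d}")
    case True
    have "(LINT s|lborel. ?K s x) = (LINT s|lborel. gg x * (indicator {c..x} s *\<^sub>R f s))"
      using True by (intro Bochner_Integration.integral_cong) (auto simp: ff_def indicator_def)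
    also have "\<dots> = gg x * (F x - F c)"
      using primitive_on_diff[OF F, of c x] True by (simp add: set_lebesgue_integral_def)
    finally show ?thesis using True by (simp add: gg_def algebra_simps)
  qed (simp add: gg_def)
  then have L: "(LINT x|lborel. (LINT s|lborel. ?K s x)) = (LINT x:{c..d}|lborel. g x * F x - F c * g x)"
    by (simp only: set_lebesgue_integral_def)
  have "(LINT x|lborel. ?K s x) = indicator {c..d} s *\<^sub>R (G d * f s - f s * G s)" for s
  proof (cases "s \<in> {c..d}")
    case True
    have "(LINT x|lborel. ?K s x) = (LINT x|lborel. ff s * (indicator {s..d} x *\<^sub>R g x))"
      using True by (intro Bochner_Integration.integral_cong) (auto simp: gg_def indicator_def)
    also have "\<dots> = ff s * (G d - G s)"
      using primitive_on_diff[OF G, of s d] True by (simp add: set_lebesgue_integral_def)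
    finally show ?thesis using True by (simp add: ff_def algebra_simps)
  qed (simp add: ff_def)
  then have R: "(LINT s|lborel. (LINT x|lborel. ?K s x)) = (LINT x:{c..d}|lborel. G d * f x - f x * G x)"
    by (simp only: set_lebesgue_integral_def)
  have "set_integrable lborel {c..d} (\<lambda>x. g x * F x)" "set_integrable lborel {c..d} (\<lambda>x. f x * G x)"
    by (intro set_integrable_mult_continuous_on f g primitive_on_continuous_on[OF F]
        primitive_on_continuous_on[OF G])+
  with Fub[unfolded L R] f g have "(LINT x:{c..d}|lborel. g x * F x) - F c * (LINT x:{c..d}|lborel. g x)
      = G d * (LINT x:{c..d}|lborel. f x) - (LINT x:{c..d}|lborel. f x * G x)"
    by simp
  \<comment> \<open>The remaining single integrals are G d - G c and F d - F c; the mixed terms F c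
    * G d cancel.\<close>
  then show ?thesis
    using primitive_on_diff[OF F, of c d] primitive_on_diff[OF G, of c d] cd by (simp add: algebra_simps)
qed

section \<open>Square-integrable functions\<close>

text \<open>The restriction to (0,1) and the weight 1/a are absorbed into the function, so that one
  notion over an arbitrary measure covers the plain and the weighted norm.\<close>

definition square_integrable :: "'a measure \<Rightarrow> ('a \<Rightarrow> real) \<Rightarrow> bool" where
  "square_integrable M f \<longleftrightarrow> f \<in> borel_measurable M \<and> integrable M (\<lambda>x. (f x)\<^sup>2)"

lemma square_integrable_mult:
  assumes "square_integrable M f" "square_integrable M g"
  shows "integrable M (\<lambda>x. f x * g x)"
proof (rule Bochner_Integration.integrable_bound)
  show "integrable M (\<lambda>x. (f x)\<^sup>2 + (g x)\<^sup>2)"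
    using assms by (auto simp: square_integrable_def)
  show "AE x in M. norm (f x * g x) \<le> norm ((f x)\<^sup>2 + (g x)\<^sup>2)"
  proof (intro always_eventually allI)
    fix x
    have "2 * (\<bar>f x\<bar> * \<bar>g x\<bar>) \<le> \<bar>f x\<bar>\<^sup>2 + \<bar>g x\<bar>\<^sup>2"
      using sum_squares_bound[of "\<bar>f x\<bar>" "\<bar>g x\<bar>"] by simp
    moreover have "0 \<le> \<bar>f x\<bar> * \<bar>g x\<bar>" by simp
    ultimately have "\<bar>f x\<bar> * \<bar>g x\<bar> \<le> (f x)\<^sup>2 + (g x)\<^sup>2"
      unfolding power2_abs by linarith
    then show "norm (f x * g x) \<le> norm ((f x)\<^sup>2 + (g x)\<^sup>2)"
      by (simp add: abs_mult)
  qed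
qed (use assms in \<open>auto simp: square_integrable_def\<close>)

lemma square_integrable_add:
  assumes "square_integrable M f" "square_integrable M g"
  shows "square_integrable M (\<lambda>x. f x + g x)"
  using assms square_integrable_mult[OF assms]
  by (auto simp: square_integrable_def power2_sum mult.assoc)

lemma square_integrable_cmult:
  assumes "square_integrable M f"
  shows "square_integrable M (\<lambda>x. c * f x)"
  using assms by (auto simp: square_integrable_def power_mult_distrib)

lemma integral_Cauchy_Schwarz:
  assumes f: "square_integrable M f" and g: "square_integrable M g"
  shows "\<bar>LINT x|M. f x * g x\<bar> \<le> sqrt (LINT x|M. (f x)\<^sup>2) * sqrt (LINT x|M. (g x)\<^sup>2)"
proof -
  let ?A = "LINT x|M. (f x)\<^sup>2" and ?B = "LINT x|M. f x * g x" and ?C = "LINT x|M. (g x)\<^sup>2"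
  have A: "?A \<ge> 0" by simp
  have "0 \<le> t\<^sup>2 * ?A + 2 * t * ?B + ?C" for t
  proof -
    have "0 \<le> (LINT x|M. (t * f x + g x)\<^sup>2)" by simp
    also have "\<dots> = (LINT x|M. t\<^sup>2 * (f x)\<^sup>2 + 2 * t * (f x * g x) + (g x)\<^sup>2)"
      by (simp add: power2_sum power_mult_distrib algebra_simps)
    also have "\<dots> = t\<^sup>2 * ?A + 2 * t * ?B + ?C"
      using f g square_integrable_mult[OF f g] by (simp add: square_integrable_def)
    finally show ?thesis .
  qed
  note quad = this
  have "?B\<^sup>2 \<le> ?A * ?C"
  proof (cases "?A = 0")
    case True
    have "?B = 0"
    proof (rule ccontr)
      assume "?B \<noteq> 0"
      \<comment> \<open>With ?A = 0 the quadratic is affine in t, and this t gives it the value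
        -1.\<close>
      then show False using quad[of "- (?C + 1) / (2 * ?B)"] True by (simp add: field_simps)
    qed
    then show ?thesis by simp
  next
    case False
    with A have "?A > 0" by linarith
    \<comment> \<open>t = -B/A is the minimiser of the quadratic.\<close>
    then show ?thesis using quad[of "- ?B / ?A"] by (simp add: field_simps power2_eq_square)
  qed
  then have "sqrt (?B\<^sup>2) \<le> sqrt (?A * ?C)" by (rule real_sqrt_le_mono)
  then show ?thesis by (simp add: real_sqrt_mult)
qed

text \<open>Write f h = f0 + h (g + r h), where r h tends to 0 in norm. The quotient equals 2 <f0,g>
  + 2 <f0,r h> + h |g + r h|^2; Cauchy-Schwarz removes the second term in the limit and the factor h
  the third. The set \<open>S\<close> admits one-sided limits.\<close>

lemma tendsto_square_integral_diff_quotient: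
  assumes f: "\<And>h. h \<in> S \<Longrightarrow> square_integrable M (f h)" and f0: "square_integrable M f0"
    and g: "square_integrable M g"
    and lim: "((\<lambda>h. LINT x|M. ((f h x - f0 x) / h - g x)\<^sup>2) \<longlongrightarrow> 0) (at 0 within S)"
  shows "((\<lambda>h. ((LINT x|M. (f h x)\<^sup>2) - (LINT x|M. (f0 x)\<^sup>2)) / h) \<longlongrightarrow> 2 * (LINT x|M. f0 x * g x))
    (at 0 within S)"
proof -
  define r where "r h x = (f h x - f0 x) / h - g x" for h x
  define R where "R h = (LINT x|M. (r h x)\<^sup>2)" for h
  have R: "(R \<longlongrightarrow> 0) (at 0 within S)"
    using lim by (simp add: R_def[abs_def] r_def)
  have r: "square_integrable M (r h)" if "h \<in> S" for h
  proof -
    have "square_integrable M (\<lambda>x. (1 / h) * f h x + ((- 1 / h) * f0 x + (- 1) * g x))"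
      by (intro square_integrable_add square_integrable_cmult f f0 g that)
    also have "(\<lambda>x. (1 / h) * f h x + ((- 1 / h) * f0 x + (- 1) * g x)) = r h"
      by (auto simp: r_def diff_divide_distrib)
    finally show ?thesis .
  qed
  have "((\<lambda>h. LINT x|M. f0 x * r h x) \<longlongrightarrow> 0) (at 0 within S)"
  proof (rule Lim_null_comparison)
    show "eventually (\<lambda>h. norm (LINT x|M. f0 x * r h x) \<le> sqrt (LINT x|M. (f0 x)\<^sup>2) * sqrt (R h)) (at 0 within S)"
      using integral_Cauchy_Schwarz[OF f0 r] by (auto simp: eventually_at_filter R_def)
    show "((\<lambda>h. sqrt (LINT x|M. (f0 x)\<^sup>2) * sqrt (R h)) \<longlongrightarrow> 0) (at 0 within S)"
      using tendsto_mult_right_zero[OF tendsto_real_sqrt[OF R, simplified]] by simp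
  qed
  note lim1 = this
  have "((\<lambda>h. h * (LINT x|M. (g x + r h x)\<^sup>2)) \<longlongrightarrow> 0) (at 0 within S)"
  proof (rule Lim_null_comparison)
    show "eventually (\<lambda>h. norm (h * (LINT x|M. (g x + r h x)\<^sup>2))
        \<le> \<bar>h\<bar> * (2 * (LINT x|M. (g x)\<^sup>2) + 2 * R h)) (at 0 within S)"
      unfolding eventually_at_filter
    proof (intro always_eventually allI impI)
      fix h assume "h \<in> S"
      have "(LINT x|M. (g x + r h x)\<^sup>2) \<le> (LINT x|M. 2 * (g x)\<^sup>2 + 2 * (r h x)\<^sup>2)"
      proof (rule integral_mono)
        show "(g x + r h x)\<^sup>2 \<le> 2 * (g x)\<^sup>2 + 2 * (r h x)\<^sup>2" for x
          using sum_squares_bound[of "g x" "r h x"] by (simp add: power2_sum)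
      qed (use g r[OF \<open>h \<in> S\<close>] square_integrable_add[OF g r[OF \<open>h \<in> S\<close>]] in \<open>auto simp: square_integrable_def\<close>)
      also have "\<dots> = 2 * (LINT x|M. (g x)\<^sup>2) + 2 * R h"
        using g r[OF \<open>h \<in> S\<close>] by (simp add: square_integrable_def R_def)
      finally show "norm (h * (LINT x|M. (g x + r h x)\<^sup>2)) \<le> \<bar>h\<bar> * (2 * (LINT x|M. (g x)\<^sup>2) + 2 * R h)"
        by (simp add: abs_mult mult_left_mono)
    qed
    have "((\<lambda>h. \<bar>h\<bar> * (2 * (LINT x|M. (g x)\<^sup>2) + 2 * R h)) \<longlongrightarrow> \<bar>0\<bar> * (2 * (LINT x|M. (g x)\<^sup>2) + 2 * 0)) (at 0 within S)"
      by (intro tendsto_intros R)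
    then show "((\<lambda>h. \<bar>h\<bar> * (2 * (LINT x|M. (g x)\<^sup>2) + 2 * R h)) \<longlongrightarrow> 0) (at 0 within S)" by simp
  qed
  from tendsto_add[OF tendsto_add[OF tendsto_const tendsto_mult_right_zero[OF lim1]] this]
  have "((\<lambda>h. 2 * (LINT x|M. f0 x * g x) + 2 * (LINT x|M. f0 x * r h x) + h * (LINT x|M. (g x + r h x)\<^sup>2))
      \<longlongrightarrow> 2 * (LINT x|M. f0 x * g x)) (at 0 within S)"
    by simp
  then show ?thesis
  proof (rule Lim_transform_eventually)
    show "eventually (\<lambda>h. 2 * (LINT x|M. f0 x * g x) + 2 * (LINT x|M. f0 x * r h x) + h * (LINT x|M. (g x + r h x)\<^sup>2)
       = ((LINT x|M. (f h x)\<^sup>2) - (LINT x|M. (f0 x)\<^sup>2)) / h) (at 0 within S)"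
      unfolding eventually_at_filter
    proof (intro always_eventually allI impI)
      fix h :: real assume h: "h \<noteq> 0" "h \<in> S"
      note gr = square_integrable_add[OF g r[OF h(2)]]
      have "(f h x)\<^sup>2 - (f0 x)\<^sup>2 = 2 * h * (f0 x * g x) + 2 * h * (f0 x * r h x) + h\<^sup>2 * (g x + r h x)\<^sup>2" for x
      proof -
        have "f h x = f0 x + h * (g x + r h x)" using h by (simp add: r_def)
        then show ?thesis by (simp only:) (simp add: power2_eq_square algebra_simps)
      qed
      then have "(LINT x|M. (f h x)\<^sup>2 - (f0 x)\<^sup>2)
        = (LINT x|M. 2 * h * (f0 x * g x) + 2 * h * (f0 x * r h x) + h\<^sup>2 * (g x + r h x)\<^sup>2)" by simp
      also have "\<dots> = 2 * h * (LINT x|M. f0 x * g x) + 2 * h * (LINT x|M. f0 x * r h x) + h\<^sup>2 * (LINT x|M. (g x + r h x)\<^sup>2)"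
        using square_integrable_mult[OF f0 g] square_integrable_mult[OF f0 r[OF h(2)]] gr
        by (simp add: square_integrable_def)
      finally show "2 * (LINT x|M. f0 x * g x) + 2 * (LINT x|M. f0 x * r h x) + h * (LINT x|M. (g x + r h x)\<^sup>2)
       = ((LINT x|M. (f h x)\<^sup>2) - (LINT x|M. (f0 x)\<^sup>2)) / h"
        using f[OF h(2)] f0 h by (simp add: square_integrable_def field_simps power2_eq_square)
    qed
  qed
qed

section \<open>The Green formula up to the degenerate endpoint\<close>

lemma L2_iff_square_integrable:
  "L2 u \<longleftrightarrow> square_integrable lborel (\<lambda>x. indicator {0<..<1} x * u x)"
proof -
  have "(\<lambda>x. indicator {0<..<1} x * (u x)\<^sup>2) = (\<lambda>x. (indicator {0<..<1::real} x * u x)\<^sup>2)"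
    by (auto simp: indicator_def fun_eq_iff)
  then show ?thesis
    by (simp add: L2_def square_integrable_def set_borel_measurable_def set_integrable_def)
qed

lemma nrm2_eq: "nrm2 u = (LINT x|lborel. (indicator {0<..<1} x * u x)\<^sup>2)"
  unfolding nrm2_def set_lebesgue_integral_def
  by (rule Bochner_Integration.integral_cong) (auto simp: indicator_def)

lemma nrm2_nonneg: "nrm2 u \<ge> 0"
  by (simp add: nrm2_eq)

lemma
  fixes f :: "real \<Rightarrow> real"
  assumes "(A - B) \<union> (B - A) \<subseteq> {c, d}" "A \<in> sets borel" "B \<in> sets borel"
  shows set_integrable_endpoints: "set_integrable lborel A f \<longleftrightarrow> set_integrable lborel B f"
    and set_integral_endpoints: "(LINT x:A|lborel. f x) = (LINT x:B|lborel. f x)"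
  by (rule set_integrable_discrete_difference[of "{c, d}"] set_integral_discrete_difference[of "{c, d}"];
      use assms in auto)+

lemma square_integrable_indicator_Icc:
  "square_integrable lborel (indicator {c..d} :: real \<Rightarrow> real)"
proof -
  have "(\<lambda>x. (indicator {c..d} x :: real)\<^sup>2) = indicator {c..d}"
    by (auto simp: indicator_def fun_eq_iff)
  then show ?thesis
    by (simp add: square_integrable_def integrable_indicator_iff emeasure_lborel_Icc_eq)
qed

lemma L2_set_integrable:
  assumes "L2 g" "0 \<le> c" "d \<le> 1"
  shows "set_integrable lborel {c..d} g"
proof -
  have "integrable lborel (\<lambda>x. indicator {0..1} x * (indicator {0<..<1} x * g x))"
    using assms(1) square_integrable_indicator_Icc unfolding L2_iff_square_integrable
    by (intro square_integrable_mult)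
  also have "(\<lambda>x. indicator {0..1} x * (indicator {0<..<1} x * g x)) = (\<lambda>x. indicator {0<..<1::real} x *\<^sub>R g x)"
    by (auto simp: indicator_def fun_eq_iff)
  finally have "set_integrable lborel {0<..<1} g"
    by (simp add: set_integrable_def)
  then have "set_integrable lborel {0..1} g"
    by (subst set_integrable_endpoints[of _ "{0<..<1}" 0 1]) auto
  then show ?thesis
    by (rule set_integrable_subset) (use assms in auto)
qed

lemma L2_integral_bound:
  assumes "L2 g" "0 \<le> c" "c \<le> d" "d \<le> 1"
  shows "\<bar>LINT s:{c..d}|lborel. g s\<bar> \<le> sqrt (d - c) * sqrt (nrm2 g)"
proof -
  have "(LINT s:{c..d}|lborel. g s) = (LINT s:{c..d} \<inter> {0<..<1}|lborel. g s)"
    by (rule set_integral_endpoints[of _ _ 0 1]) (use assms in auto)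
  also have "\<dots> = (LINT s|lborel. indicator {c..d} s * (indicator {0<..<1} s * g s))"
    by (simp add: set_lebesgue_integral_def indicator_inter_arith mult.assoc)
  also have "\<bar>\<dots>\<bar> \<le> sqrt (LINT s|lborel. (indicator {c..d} s)\<^sup>2) * sqrt (nrm2 g)"
    unfolding nrm2_eq using assms(1)
    by (intro integral_Cauchy_Schwarz square_integrable_indicator_Icc) (simp add: L2_iff_square_integrable)
  also have "(LINT s|lborel. (indicator {c..d} s)\<^sup>2) = (LINT s|lborel. indicator {c..d} s :: real)"
    by (rule Bochner_Integration.integral_cong) (auto simp: indicator_def)
  also have "\<dots> = d - c" using assms by simp
  finally show ?thesis .
qed

lemma H2w0_primitive:
  assumes "H2w0 a u u1 u2"
  shows "primitive_on 0 1 u u1" "primitive_on 0 1 u1 u2"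
proof -
  have c: "continuous_on {0..1} u" "continuous_on {0..1} u1" and u2: "L2 u2"
    and wd: "weak_deriv 0 1 u u1" "weak_deriv 0 1 u1 u2"
    using assms by (auto simp: H2w0_def)
  have c': "continuous_on {0<..<1} u" "continuous_on {0<..<1} u1"
    by (rule continuous_on_subset[OF c(1)] continuous_on_subset[OF c(2)]; auto)+
  show "primitive_on 0 1 u u1"
    by (rule weak_deriv_primitive_on[OF wd(1)]) (use c c' in \<open>auto intro: borel_integrable_atLeastAtMost'\<close>)
  show "primitive_on 0 1 u1 u2"
    by (rule weak_deriv_primitive_on[OF wd(2)]) (use c c' u2 in \<open>auto intro: L2_set_integrable\<close>)
qed

text \<open>Cauchy-Schwarz on [0,x] bounds \<open>u1\<close>, and integrating that bound, which
  increases with x, costs one more factor x. Small x gives the decay of the boundary terms at 0; x =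
  1 gives the control of the traces.\<close>

lemma primitive_bounds:
  assumes prim: "primitive_on 0 1 u u1" "primitive_on 0 1 u1 u2" and u2: "L2 u2"
    and zero: "u 0 = 0" "u1 0 = 0" and x: "0 \<le> x" "x \<le> 1"
  shows "\<bar>u1 x\<bar> \<le> sqrt x * sqrt (nrm2 u2)" and "\<bar>u x\<bar> \<le> sqrt x * sqrt (nrm2 u2) * x"
proof -
  have b: "\<bar>u1 z\<bar> \<le> sqrt z * sqrt (nrm2 u2)" if "0 \<le> z" "z \<le> 1" for z
    using primitive_on_diff[OF prim(2), of 0 z] L2_integral_bound[OF u2, of 0 z] that zero by simp
  show "\<bar>u1 x\<bar> \<le> sqrt x * sqrt (nrm2 u2)" by (rule b[OF x])
  have "u x = (LINT s:{0..x}|lborel. u1 s)"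
    using primitive_on_diff[OF prim(1), of 0 x] x zero by simp
  also have "\<dots> = integral {0..x} u1"
    by (rule set_borel_integral_eq_integral(2), rule set_integrable_subset[of _ "{0..1}"])
       (use prim(1) x in \<open>auto simp: primitive_on_def\<close>)
  finally have ux: "u x = integral {0..x} u1" .
  have "norm (integral {0..x} u1) \<le> sqrt x * sqrt (nrm2 u2) * (x - 0)"
  proof (rule integral_bound)
    show "continuous_on {0..x} u1"
      by (rule continuous_on_subset[OF primitive_on_continuous_on[OF prim(2)]]) (use x in auto)
    show "norm (u1 t) \<le> sqrt x * sqrt (nrm2 u2)" if "t \<in> {0..x}" for t
    proof -
      have "\<bar>u1 t\<bar> \<le> sqrt t * sqrt (nrm2 u2)" using b[of t] that x by auto
      also have "\<dots> \<le> sqrt x * sqrt (nrm2 u2)"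
        using that by (intro mult_right_mono) (auto simp: nrm2_nonneg)
      finally show ?thesis by simp
    qed
  qed (use x in auto)
  then show "\<bar>u x\<bar> \<le> sqrt x * sqrt (nrm2 u2) * x" by (simp add: ux)
qed

section \<open>Growth estimates towards the degenerate endpoint\<close>

lemma integral_inverse_square:
  assumes "0 < \<delta>" "\<delta> \<le> (1::real)"
  shows "(LINT s|lborel. (indicator {\<delta>..1} s * (1 / s))\<^sup>2) = 1 / \<delta> - 1"
    and "square_integrable lborel (\<lambda>s. indicator {\<delta>..1} s * (1 / s))"
proof -
  have eq: "(\<lambda>s. (indicator {\<delta>..1} s * (1 / s))\<^sup>2) = (\<lambda>s::real. indicator {\<delta>..1} s *\<^sub>R (1 / s\<^sup>2))"
    by (auto simp: indicator_def fun_eq_iff power_divide)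
  have cont: "continuous_on {\<delta>..1} (\<lambda>s::real. 1 / s\<^sup>2)"
    using assms by (auto intro!: continuous_intros)
  have "(LINT s|lborel. indicator {\<delta>..1} s *\<^sub>R (1 / s\<^sup>2)) = (- 1 / 1) - (- 1 / \<delta>)"
  proof (rule integral_FTC_atLeastAtMost[OF assms(2) _ cont])
    fix x :: real assume "\<delta> \<le> x" "x \<le> 1"
    then show "((\<lambda>s. - 1 / s) has_vector_derivative 1 / x\<^sup>2) (at x within {\<delta>..1})"
      unfolding has_real_derivative_iff_has_vector_derivative[symmetric]
      using assms by (auto intro!: derivative_eq_intros simp: power2_eq_square)
  qed
  then show "(LINT s|lborel. (indicator {\<delta>..1} s * (1 / s))\<^sup>2) = 1 / \<delta> - 1"
    unfolding eq by simp
  have "(\<lambda>s::real. indicator {\<delta>..1} s * (1 / s)) \<in> borel_measurable lborel"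
    by measurable
  moreover have "integrable lborel (\<lambda>s. indicator {\<delta>..1} s *\<^sub>R (1 / s\<^sup>2))"
    using borel_integrable_atLeastAtMost'[OF cont] by (simp add: set_integrable_def)
  ultimately show "square_integrable lborel (\<lambda>s. indicator {\<delta>..1} s * (1 / s))"
    by (simp only: square_integrable_def eq)
qed

text \<open>Cauchy-Schwarz for g = (1/s) * (s g): the norm of 1/s on [\<delta>,1] is sqrt
  (1/\<delta> - 1), which is the origin of the rate x^(-1/2) for u'''.\<close>

lemma singular_integral_bound:
  assumes g: "L2 (\<lambda>x. x * g x)" and \<delta>: "0 < \<delta>" "\<delta> \<le> 1"
  shows "set_integrable lborel {\<delta>..1} g"
    and "\<bar>LINT s:{\<delta>..1}|lborel. g s\<bar> \<le> sqrt (nrm2 (\<lambda>x. x * g x)) / sqrt \<delta>"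
proof -
  have "set_integrable lborel {\<delta>..1} (\<lambda>x. x * g x * (1 / x))"
    using \<delta> by (intro set_integrable_mult_continuous_on L2_set_integrable[OF g] continuous_intros) auto
  then show "set_integrable lborel {\<delta>..1} g"
    by (rule set_integrable_cong[THEN iffD1, rotated -1]) (use \<delta> in auto)
  have "(LINT s:{\<delta>..1}|lborel. g s) = (LINT s:{\<delta>..1} \<inter> {0<..<1}|lborel. g s)"
    by (rule set_integral_endpoints[of _ _ 0 1]) (use \<delta> in auto)
  also have "\<dots> = (LINT s|lborel. (indicator {\<delta>..1} s * (1 / s)) * (indicator {0<..<1} s * (s * g s)))"
    unfolding set_lebesgue_integral_def
    by (rule Bochner_Integration.integral_cong) (auto simp: indicator_def)
  also have "\<bar>\<dots>\<bar> \<le> sqrt (LINT s|lborel. (indicator {\<delta>..1} s * (1 / s))\<^sup>2) * sqrt (nrm2 (\<lambda>x. x * g x))"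
    unfolding nrm2_eq using g
    by (intro integral_Cauchy_Schwarz integral_inverse_square \<delta>) (simp add: L2_iff_square_integrable)
  also have "\<dots> \<le> (1 / sqrt \<delta>) * sqrt (nrm2 (\<lambda>x. x * g x))"
  proof (rule mult_right_mono)
    have "sqrt (1 / \<delta> - 1) \<le> sqrt (1 / \<delta>)" by simp
    then show "sqrt (LINT s|lborel. (indicator {\<delta>..1} s * (1 / s))\<^sup>2) \<le> 1 / sqrt \<delta>"
      unfolding integral_inverse_square(1)[OF \<delta>] by (simp add: real_sqrt_divide)
  qed (simp add: nrm2_nonneg)
  finally show "\<bar>LINT s:{\<delta>..1}|lborel. g s\<bar> \<le> sqrt (nrm2 (\<lambda>x. x * g x)) / sqrt \<delta>" by simp
qed

text \<open>The singularity s^(-1/2) is integrable with integral 2 over (0,1), whence a bound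
  independent of \<delta>.\<close>

lemma integral_inverse_sqrt_bound:
  fixes g :: "real \<Rightarrow> real"
  assumes \<delta>: "0 < \<delta>" "\<delta> \<le> 1" and g: "set_integrable lborel {\<delta>..1} g"
    and bound: "\<And>s. s \<in> {\<delta>..1} \<Longrightarrow> \<bar>g s\<bar> \<le> C / sqrt s"
  shows "\<bar>LINT s:{\<delta>..1}|lborel. g s\<bar> \<le> 2 * C"
proof -
  have "C \<ge> 0" using bound[of 1] \<delta> by auto
  have "continuous_on {\<delta>..1} (\<lambda>s. C / sqrt s)"
    using \<delta> by (auto intro!: continuous_intros)
  note cont = this
  have "\<bar>LINT s:{\<delta>..1}|lborel. g s\<bar> \<le> (LINT s:{\<delta>..1}|lborel. \<bar>g s\<bar>)"
    unfolding set_lebesgue_integral_def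
    by (rule order_trans[OF integral_abs_bound]) (simp add: abs_mult)
  also have "\<dots> \<le> (LINT s:{\<delta>..1}|lborel. C / sqrt s)"
    by (rule set_integral_mono) (auto intro: set_integrable_abs g bound borel_integrable_atLeastAtMost' cont)
  also have "\<dots> = 2 * C * sqrt 1 - 2 * C * sqrt \<delta>"
    unfolding set_lebesgue_integral_def
  proof (rule integral_FTC_atLeastAtMost[OF \<delta>(2) _ cont])
    fix x :: real assume "\<delta> \<le> x" "x \<le> 1"
    then show "((\<lambda>s. 2 * C * sqrt s) has_vector_derivative C / sqrt x) (at x within {\<delta>..1})"
      unfolding has_real_derivative_iff_has_vector_derivative[symmetric]
      using \<delta> by (auto intro!: derivative_eq_intros simp: field_simps)
  qed
  also have "\<dots> \<le> 2 * C" using \<open>C \<ge> 0\<close> \<delta> by simp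
  finally show ?thesis .
qed

lemma degenerate_Green_formula:
  assumes v: "primitive_on 0 1 v v1" "primitive_on 0 1 v1 v2" "L2 v2" "v 0 = 0" "v1 0 = 0"
    and u: "continuous_on {0<..1} u2" "continuous_on {0<..1} u3" "L2 u2"
    and wd: "weak_deriv 0 1 u2 u3" "weak_deriv 0 1 u3 u4" and u4: "L2 (\<lambda>x. x * u4 x)"
    and int: "set_integrable lborel {0<..<1} (\<lambda>x. u4 x * v x)"
  shows "(LINT x:{0<..<1}|lborel. u4 x * v x) - (LINT x:{0<..<1}|lborel. u2 x * v2 x)
    = v 1 * u3 1 - v1 1 * u2 1"
proof -
  \<comment> \<open>\<open>C\<close> bounds sqrt \<delta> * |u3 \<delta>|, since |u3 1| is at most
    |u3 1| / sqrt \<delta>; \<open>D\<close> adds to |u2 1| the integral of C / sqrt s.\<close>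
  define N where "N = sqrt (nrm2 v2)"
  define C where "C = \<bar>u3 1\<bar> + sqrt (nrm2 (\<lambda>x. x * u4 x))"
  define D where "D = \<bar>u2 1\<bar> + 2 * C"
  have prim: "primitive_on \<delta> 1 u2 u3" "primitive_on \<delta> 1 u3 u4" if "0 < \<delta>" "\<delta> < 1" for \<delta>
  proof -
    have c2: "continuous_on {\<delta>..1} u2" "continuous_on {0<..<1} u2"
      by (rule continuous_on_subset[OF u(1)]; use that in auto)+
    have c3: "continuous_on {\<delta>..1} u3" "continuous_on {0<..<1} u3"
      by (rule continuous_on_subset[OF u(2)]; use that in auto)+
    show "primitive_on \<delta> 1 u2 u3"
      by (rule weak_deriv_primitive_on[OF wd(1)])
         (use that c2 c3 in \<open>auto intro: borel_integrable_atLeastAtMost'\<close>)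
    show "primitive_on \<delta> 1 u3 u4"
      by (rule weak_deriv_primitive_on[OF wd(2)])
         (use that c3 in \<open>auto intro: singular_integral_bound[OF u4]\<close>)
  qed
  have u3: "\<bar>u3 \<delta>\<bar> \<le> C / sqrt \<delta>" if "0 < \<delta>" "\<delta> \<le> 1" for \<delta>
  proof (cases "\<delta> = 1")
    case False
    then have "u3 1 - u3 \<delta> = (LINT s:{\<delta>..1}|lborel. u4 s)"
      using that by (intro primitive_on_diff[OF prim(2)]) auto
    then have "\<bar>u3 \<delta>\<bar> \<le> \<bar>u3 1\<bar> + sqrt (nrm2 (\<lambda>x. x * u4 x)) / sqrt \<delta>"
      using singular_integral_bound(2)[OF u4 that] by linarith
    also have "\<bar>u3 1\<bar> \<le> \<bar>u3 1\<bar> / sqrt \<delta>"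
      using that mult_left_mono[of "sqrt \<delta>" 1 "\<bar>u3 1\<bar>"] by (simp add: field_simps)
    finally show ?thesis by (simp add: C_def add_divide_distrib)
  qed (simp add: C_def nrm2_nonneg)
  have u2: "\<bar>u2 \<delta>\<bar> \<le> D" if "0 < \<delta>" "\<delta> < 1" for \<delta>
  proof -
    have "u2 1 - u2 \<delta> = (LINT s:{\<delta>..1}|lborel. u3 s)"
      using that by (intro primitive_on_diff[OF prim(1)]) auto
    moreover have "\<bar>LINT s:{\<delta>..1}|lborel. u3 s\<bar> \<le> 2 * C"
      by (rule integral_inverse_sqrt_bound) (use that prim(1)[OF that] u3 in \<open>auto simp: primitive_on_def\<close>)
    ultimately show ?thesis unfolding D_def by linarith
  qed
  have at_right: "eventually (\<lambda>\<delta>::real. 0 < \<delta> \<and> \<delta> < 1) (at_right 0)"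
    by (rule eventually_at_rightI[of 0 1]) auto
  have "((\<lambda>\<delta>. v \<delta> * u3 \<delta>) \<longlongrightarrow> 0) (at_right 0)"
  proof (rule Lim_null_comparison)
    show "eventually (\<lambda>\<delta>. norm (v \<delta> * u3 \<delta>) \<le> N * C * \<delta>) (at_right 0)"
      using at_right
    proof eventually_elim
      case (elim \<delta>)
      \<comment> \<open>Rates \<delta>^(3/2) and \<delta>^(-1/2) leave one full power of
        \<delta>.\<close>
      have "norm (v \<delta> * u3 \<delta>) \<le> (sqrt \<delta> * N * \<delta>) * (C / sqrt \<delta>)"
        using primitive_bounds(2)[OF v, of \<delta>] u3[of \<delta>] elim unfolding N_def[symmetric] norm_mult
        by (intro mult_mono) (auto simp: N_def nrm2_nonneg)
      then show ?case using elim by (simp add: mult.commute mult.left_commute)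
    qed
    have "((\<lambda>\<delta>. N * C * \<delta>) \<longlongrightarrow> N * C * 0) (at_right 0)" by (intro tendsto_intros)
    then show "((\<lambda>\<delta>. N * C * \<delta>) \<longlongrightarrow> 0) (at_right 0)" by simp
  qed
  note lim_v = this
  have "((\<lambda>\<delta>. v1 \<delta> * u2 \<delta>) \<longlongrightarrow> 0) (at_right 0)"
  proof (rule Lim_null_comparison)
    show "eventually (\<lambda>\<delta>. norm (v1 \<delta> * u2 \<delta>) \<le> sqrt \<delta> * N * D) (at_right 0)"
      using at_right
    proof eventually_elim
      case (elim \<delta>)
      show "norm (v1 \<delta> * u2 \<delta>) \<le> (sqrt \<delta> * N) * D"
        using primitive_bounds(1)[OF v, of \<delta>] u2[of \<delta>] elim unfolding N_def[symmetric] norm_mult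
        by (intro mult_mono) (auto simp: N_def nrm2_nonneg)
    qed
    have "((\<lambda>\<delta>. sqrt \<delta> * N * D) \<longlongrightarrow> sqrt 0 * N * D) (at_right 0)" by (intro tendsto_intros)
    then show "((\<lambda>\<delta>. sqrt \<delta> * N * D) \<longlongrightarrow> 0) (at_right 0)" by simp
  qed
  note lim_v1 = this
  have "integrable lborel (\<lambda>x. (indicator {0<..<1} x * u2 x) * (indicator {0<..<1} x * v2 x))"
    using u(3) v(3) unfolding L2_iff_square_integrable by (rule square_integrable_mult)
  also have "(\<lambda>x. (indicator {0<..<1} x * u2 x) * (indicator {0<..<1} x * v2 x))
      = (\<lambda>x. indicator {0<..<1::real} x *\<^sub>R (u2 x * v2 x))"
    by (auto simp: indicator_def fun_eq_iff)
  finally have int2: "set_integrable lborel {0<..<1} (\<lambda>x. u2 x * v2 x)"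
    by (simp add: set_integrable_def)
  \<comment> \<open>The limit \<delta> -> 0 produces the half-open interval, whereas the function
    spaces live on the open one.\<close>
  have ends: "set_integrable lborel {0<..1} f \<longleftrightarrow> set_integrable lborel {0<..<1} f"
    "(LINT x:{0<..1}|lborel. f x) = (LINT x:{0<..<1}|lborel. f x)" for f :: "real \<Rightarrow> real"
    by (rule set_integrable_endpoints[of _ _ 0 1] set_integral_endpoints[of _ _ 0 1]; auto)+
  let ?h = "\<lambda>x. u4 x * v x - u2 x * v2 x"
  have "((\<lambda>\<delta>. LINT x:{\<delta>..1}|lborel. ?h x) \<longlongrightarrow> (LINT x:{0<..1}|lborel. ?h x)) (at_right 0)"
    by (rule tendsto_set_lebesgue_integral_at_right) (use int int2 in \<open>auto simp: ends\<close>)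
  moreover have "((\<lambda>\<delta>. v 1 * u3 1 - v \<delta> * u3 \<delta> - (v1 1 * u2 1 - v1 \<delta> * u2 \<delta>)) \<longlongrightarrow>
      v 1 * u3 1 - 0 - (v1 1 * u2 1 - 0)) (at_right 0)"
    by (intro tendsto_intros lim_v lim_v1)
  moreover have "eventually (\<lambda>\<delta>. v 1 * u3 1 - v \<delta> * u3 \<delta> - (v1 1 * u2 1 - v1 \<delta> * u2 \<delta>)
      = (LINT x:{\<delta>..1}|lborel. ?h x)) (at_right 0)"
    using at_right
  proof eventually_elim
    case (elim \<delta>)
    have V: "primitive_on \<delta> 1 v v1" "primitive_on \<delta> 1 v1 v2"
      by (rule primitive_on_subset[OF v(1)] primitive_on_subset[OF v(2)]; use elim in auto)+
    have U: "primitive_on \<delta> 1 u2 u3" "primitive_on \<delta> 1 u3 u4"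
      using prim elim by auto
    have "set_integrable lborel {\<delta>..1} (\<lambda>x. u4 x * v x)" "set_integrable lborel {\<delta>..1} (\<lambda>x. u2 x * v2 x)"
      by (rule set_integrable_subset[of _ "{0<..1}"]; use elim int int2 in \<open>auto simp: ends\<close>)+
    then have "(LINT x:{\<delta>..1}|lborel. ?h x)
        = (LINT x:{\<delta>..1}|lborel. u4 x * v x) - (LINT x:{\<delta>..1}|lborel. u2 x * v2 x)"
      by (rule set_integral_diff)
    \<comment> \<open>The integral of v1 * u3 left over here is eliminated by the second integration
      by parts.\<close>
    moreover have "(LINT x:{\<delta>..1}|lborel. u4 x * v x)
        = v 1 * u3 1 - v \<delta> * u3 \<delta> - (LINT x:{\<delta>..1}|lborel. v1 x * u3 x)"
      by (rule primitive_on_integral_by_parts) (use V U elim in auto)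
    moreover have "(LINT x:{\<delta>..1}|lborel. u3 x * v1 x)
        = v1 1 * u2 1 - v1 \<delta> * u2 \<delta> - (LINT x:{\<delta>..1}|lborel. v2 x * u2 x)"
      by (rule primitive_on_integral_by_parts) (use V U elim in auto)
    ultimately show ?case by (simp add: mult.commute)
  qed
  ultimately have "((\<lambda>\<delta>. LINT x:{\<delta>..1}|lborel. ?h x) \<longlongrightarrow> v 1 * u3 1 - v1 1 * u2 1) (at_right 0)"
    by (simp cong: filterlim_cong)
  then have "(LINT x:{0<..1}|lborel. ?h x) = v 1 * u3 1 - v1 1 * u2 1"
    using \<open>((\<lambda>\<delta>. LINT x:{\<delta>..1}|lborel. ?h x) \<longlongrightarrow> (LINT x:{0<..1}|lborel. ?h x)) (at_right 0)\<close>
    by (intro tendsto_unique[of "at_right (0::real)"]) auto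
  then show ?thesis using int int2 by (simp add: ends)
qed

section \<open>The degenerate coefficient and the weighted space\<close>

lemma degenerate_coefficient:
  assumes "WD a \<or> SD a"
  shows "continuous_on {0<..1} a" "\<And>x. x \<in> {0<..1} \<Longrightarrow> a x > 0"
    and "\<And>x. x \<in> {0<..1} \<Longrightarrow> a 1 * x\<^sup>2 \<le> a x"
proof -
  \<comment> \<open>Common ground of the two cases: a derivative on (0,1] and K < 2, which is weaker
    than K < 1 in the case \<open>WD\<close>.\<close>
  have "\<exists>a'. (\<forall>x\<in>{0<..1}. (a has_real_derivative a' x) (at x within {0<..1})) \<and>
      bdd_above ((\<lambda>x. x * \<bar>a' x\<bar> / a x) ` {0<..1}) \<and> Kconst a a' < 2"
    using assms
  proof
    assume "SD a"
    then obtain a' where "\<forall>x\<in>{0..1}. (a has_real_derivative a' x) (at x within {0..1})"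
      "bdd_above ((\<lambda>x. x * \<bar>a' x\<bar> / a x) ` {0<..1})" "Kconst a a' < 2"
      by (auto simp: SD_def)
    then show ?thesis
      by (intro exI[of _ a']) (auto intro: DERIV_subset[of _ _ _ "{0..1}"])
  next
    assume "WD a"
    then show ?thesis by (force simp: WD_def)
  qed
  then obtain a' where deriv: "\<And>x. x \<in> {0<..1} \<Longrightarrow> (a has_real_derivative a' x) (at x within {0<..1})"
    and bdd: "bdd_above ((\<lambda>x. x * \<bar>a' x\<bar> / a x) ` {0<..1})" and K: "Kconst a a' < 2"
    by blast
  show pos: "\<And>x. x \<in> {0<..1} \<Longrightarrow> a x > 0"
    using assms by (auto simp: WD_def SD_def)
  show cont: "continuous_on {0<..1} a"
    using deriv DERIV_continuous by (fastforce simp: continuous_on_eq_continuous_within)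
  show "a 1 * x\<^sup>2 \<le> a x" if x: "x \<in> {0<..1}" for x
  proof -
    have "a x / x\<^sup>2 \<ge> a 1 / 1\<^sup>2"
    proof (rule DERIV_nonpos_imp_decreasing_open[where f = "\<lambda>x. a x / x\<^sup>2"])
      show "x \<le> 1" using x by simp
      show "continuous_on {x..1} (\<lambda>x. a x / x\<^sup>2)"
        by (intro continuous_intros continuous_on_subset[OF cont]) (use x in auto)
      fix z assume z: "x < z" "z < 1"
      then have z': "z \<in> {0<..<1}" "z \<in> {0<..1}" using x by auto
      have "(a has_real_derivative a' z) (at z)"
        using deriv[OF z'(2)] at_within_open_subset[OF z'(1) open_greaterThanLessThan, of "{0<..1}"]
        by (simp add: subset_eq)
      then have D: "((\<lambda>x. a x / x\<^sup>2) has_real_derivative (a' z * z\<^sup>2 - a z * (2 * z)) / (z\<^sup>2 * z\<^sup>2)) (at z)"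
        using z' by (auto intro!: derivative_eq_intros)
      have "z * \<bar>a' z\<bar> / a z \<le> Kconst a a'"
        unfolding Kconst_def by (rule cSUP_upper[OF z'(2) bdd])
      then have "z * \<bar>a' z\<bar> \<le> 2 * a z"
        using K pos_divide_le_eq[OF pos[OF z'(2)], of "z * \<bar>a' z\<bar>" 2] by linarith
      moreover have "z * a' z \<le> z * \<bar>a' z\<bar>"
        using z' by (intro mult_left_mono) auto
      ultimately have "z * a' z - 2 * a z \<le> 0" by linarith
      \<comment> \<open>Up to the positive denominator z^4 this is the derivative of
        a(z)/z^2.\<close>
      then have "z * (z * a' z - 2 * a z) \<le> 0"
        using z' by (intro mult_nonneg_nonpos) auto
      then have "a' z * z\<^sup>2 - a z * (2 * z) \<le> 0"
        by (simp add: power2_eq_square algebra_simps)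
      then have "(a' z * z\<^sup>2 - a z * (2 * z)) / (z\<^sup>2 * z\<^sup>2) \<le> 0"
        by (intro divide_nonpos_nonneg) auto
      with D show "\<exists>y. ((\<lambda>x. a x / x\<^sup>2) has_real_derivative y) (at z) \<and> y \<le> 0" by blast
    qed
    then show ?thesis using x by (simp add: le_divide_eq)
  qed
qed

text \<open>Division by sqrt(a) is the isometry from the weighted space to plain L^2; the indicator
  extends the result by 0 to the line.\<close>

definition weighted :: "(real \<Rightarrow> real) \<Rightarrow> (real \<Rightarrow> real) \<Rightarrow> real \<Rightarrow> real" where
  "weighted a u x = indicator {0<..<1} x * (u x / sqrt (a x))"

context
  fixes a :: "real \<Rightarrow> real"
  assumes deg: "WD a \<or> SD a"
begin

lemma weighted_mult: "weighted a u x * weighted a v x = indicator {0<..<1} x * (u x * v x / a x)"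
  using degenerate_coefficient(2)[OF deg, of x] by (auto simp: weighted_def indicator_def)

lemma weighted_square: "(weighted a u x)\<^sup>2 = indicator {0<..<1} x * ((u x)\<^sup>2 / a x)"
  using weighted_mult[of u x u] by (simp add: power2_eq_square)

lemma nrm2w_eq: "nrm2w a u = (LINT x|lborel. (weighted a u x)\<^sup>2)"
  by (simp add: nrm2w_def set_lebesgue_integral_def weighted_square)

lemma nrm2_le_distH2: "nrm2 (\<lambda>x. u2 x - v2 x) \<le> distH2 a u u2 v v2"
  by (simp add: distH2_def nrm2w_eq)

lemma L2w_square_integrable:
  assumes "L2w a u"
  shows "square_integrable lborel (weighted a u)"
proof -
  have "continuous_on {0<..<1} (\<lambda>x. 1 / sqrt (a x))"
    using degenerate_coefficient(2)[OF deg]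
    by (intro continuous_intros continuous_on_subset[OF degenerate_coefficient(1)[OF deg]]) force+
  then have "(\<lambda>x. indicator {0<..<1} x *\<^sub>R (1 / sqrt (a x))) \<in> borel_measurable lborel"
    unfolding measurable_lborel2 by (intro borel_measurable_continuous_on_indicator) auto
  moreover have "(\<lambda>x. indicator {0<..<1} x * u x) \<in> borel_measurable lborel"
    using assms by (simp add: L2w_def L2_iff_square_integrable square_integrable_def)
  ultimately have "(\<lambda>x. (indicator {0<..<1} x * u x) * (indicator {0<..<1} x *\<^sub>R (1 / sqrt (a x)))) \<in> borel_measurable lborel"
    by (rule borel_measurable_times[rotated])
  also have "(\<lambda>x. (indicator {0<..<1} x * u x) * (indicator {0<..<1} x *\<^sub>R (1 / sqrt (a x)))) = weighted a u"
    by (auto simp: weighted_def indicator_def fun_eq_iff)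
  finally show ?thesis
    using assms by (simp add: square_integrable_def weighted_square L2w_def set_integrable_def)
qed

text \<open>The weighted square of a w is a w^2, and a 1 * x^2 \<le> a x bounds (x w)^2 by a w^2 / a
  1. This is where the restriction K < 2 enters.\<close>

lemma L2w_fourth_derivative:
  assumes "L2w a (\<lambda>x. a x * w x)"
  shows "L2 (\<lambda>x. x * w x)"
proof -
  note a = degenerate_coefficient[OF deg]
  have a1: "a 1 > 0" using a(2) by simp
  have "continuous_on {0<..<1} (\<lambda>x. x / sqrt (a x))"
    using a(2) by (intro continuous_intros continuous_on_subset[OF a(1)]) force+
  then have m: "(\<lambda>x. indicator {0<..<1} x *\<^sub>R (x / sqrt (a x))) \<in> borel_measurable lborel"
    unfolding measurable_lborel2 by (intro borel_measurable_continuous_on_indicator) auto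
  have W: "square_integrable lborel (weighted a (\<lambda>x. a x * w x))"
    by (rule L2w_square_integrable[OF assms])
  \<comment> \<open>For measurability: what is known is that sqrt(a) w is measurable on (0,1), and
    multiplying by the continuous x / sqrt(a) gives x w.\<close>
  have eq: "indicator {0<..<1} x * (x * w x)
      = weighted a (\<lambda>x. a x * w x) x * (indicator {0<..<1} x *\<^sub>R (x / sqrt (a x)))" for x
  proof (cases "x \<in> {0<..<1}")
    case True
    then have "a x > 0" using a(2) by auto
    then have "sqrt (a x) * sqrt (a x) = a x" by simp
    with True \<open>a x > 0\<close> show ?thesis by (simp add: weighted_def field_simps)
  qed (simp add: weighted_def)
  show ?thesis
    unfolding L2_iff_square_integrable square_integrable_def
  proof
    show meas: "(\<lambda>x. indicator {0<..<1} x * (x * w x)) \<in> borel_measurable lborel"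
      unfolding eq using W m by (intro borel_measurable_times) (auto simp: square_integrable_def)
    show "integrable lborel (\<lambda>x. (indicator {0<..<1} x * (x * w x))\<^sup>2)"
    proof (rule Bochner_Integration.integrable_bound)
      show "integrable lborel (\<lambda>x. (1 / a 1) * (weighted a (\<lambda>x. a x * w x) x)\<^sup>2)"
        using W by (simp add: square_integrable_def)
      show "(\<lambda>x. (indicator {0<..<1} x * (x * w x))\<^sup>2) \<in> borel_measurable lborel"
        using meas by (rule borel_measurable_power)
      show "AE x in lborel. norm ((indicator {0<..<1} x * (x * w x))\<^sup>2)
          \<le> norm ((1 / a 1) * (weighted a (\<lambda>x. a x * w x) x)\<^sup>2)"
      proof (intro always_eventually allI)
        fix x show "norm ((indicator {0<..<1} x * (x * w x))\<^sup>2)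
          \<le> norm ((1 / a 1) * (weighted a (\<lambda>x. a x * w x) x)\<^sup>2)"
        proof (cases "x \<in> {0<..<1}")
          case True
          then have "a x > 0" "a 1 * x\<^sup>2 \<le> a x" using a(2,3) by auto
          then have "(a 1 * x\<^sup>2) * (w x)\<^sup>2 \<le> a x * (w x)\<^sup>2" by (intro mult_right_mono) auto
          then have "x\<^sup>2 * (w x)\<^sup>2 \<le> (1 / a 1) * (a x * (w x)\<^sup>2)"
            using a1 by (simp add: le_divide_eq mult_ac)
          moreover have "(weighted a (\<lambda>x. a x * w x) x)\<^sup>2 = a x * (w x)\<^sup>2"
            unfolding weighted_square using True \<open>a x > 0\<close> by (simp add: power2_eq_square)
          ultimately show ?thesis using True a1 \<open>a x > 0\<close> by (simp add: power_mult_distrib abs_mult)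
        qed simp
      qed
    qed
  qed
qed

text \<open>In the weighted pairing the factor a in front of u4 cancels the weight, leaving the
  integral of u4 * v; its integrability is that of a product of two square-integrable functions. The
  left side is written in the pairings that arise from differentiating the energy.\<close>

lemma DA_Green_formula:
  assumes u: "DA a u u1 u2 u3 u4" and v: "H2w0 a v v1 v2"
  shows "(LINT x|lborel. weighted a (\<lambda>x. a x * u4 x) x * weighted a v x)
      - (LINT x|lborel. (indicator {0<..<1} x * u2 x) * (indicator {0<..<1} x * v2 x))
    = v 1 * u3 1 - v1 1 * u2 1"
proof -
  have eq: "weighted a (\<lambda>x. a x * u4 x) x * weighted a v x = indicator {0<..<1} x *\<^sub>R (u4 x * v x)" for x
    unfolding weighted_mult using degenerate_coefficient(2)[OF deg, of x] by (auto simp: indicator_def)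
  have w: "L2w a (\<lambda>x. a x * u4 x)" and "L2w a v" using u v by (auto simp: DA_def H2w0_def)
  then have int: "set_integrable lborel {0<..<1} (\<lambda>x. u4 x * v x)"
    using square_integrable_mult[OF L2w_square_integrable L2w_square_integrable]
    unfolding set_integrable_def eq[symmetric] by blast
  have "(LINT x:{0<..<1}|lborel. u4 x * v x) - (LINT x:{0<..<1}|lborel. u2 x * v2 x)
      = v 1 * u3 1 - v1 1 * u2 1"
    by (rule degenerate_Green_formula[OF H2w0_primitive[OF v] _ _ _ _ _ _ _ _ L2w_fourth_derivative[OF w] int])
       (use u v in \<open>auto simp: DA_def H2w0_def\<close>)
  moreover have "(LINT x|lborel. (indicator {0<..<1} x * u2 x) * (indicator {0<..<1} x * v2 x))
      = (LINT x:{0<..<1}|lborel. u2 x * v2 x)"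
    unfolding set_lebesgue_integral_def by (rule Bochner_Integration.integral_cong) (auto simp: indicator_def)
  ultimately show ?thesis by (simp add: set_lebesgue_integral_def eq)
qed

end

section \<open>The energy identity\<close>

text \<open>The increments admissible at time t are h \<ge> -t, and translation by t maps them onto
  [0,\<infinity>).\<close>

lemma has_real_derivative_within_halfline:
  assumes "((\<lambda>h. (f (t + h) - f t) / h) \<longlongrightarrow> D) (at 0 within {-t..})"
  shows "(f has_real_derivative D) (at t within {0..})"
proof -
  have "(+) t ` {-t..} = {0..}"
    by (simp add: image_add_atLeast)
  then show ?thesis
    using assms DERIV_at_within_shift[of f D t 0 "{-t..}"] by (simp add: has_field_derivative_iff)
qed

lemma primitive_on_lincomb:
  assumes "primitive_on c d u g" "primitive_on c d v k"
  shows "primitive_on c d (\<lambda>x. r * u x + s * v x) (\<lambda>x. r * g x + s * k x)"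
  unfolding primitive_on_def
proof (intro conjI ballI)
  have int: "set_integrable lborel {c..d} g" "set_integrable lborel {c..d} k"
    using assms by (auto simp: primitive_on_def)
  then show "set_integrable lborel {c..d} (\<lambda>x. r * g x + s * k x)" by simp
  fix x assume x: "x \<in> {c..d}"
  have "set_integrable lborel {c..x} g" "set_integrable lborel {c..x} k"
    by (rule set_integrable_subset[OF int(1)] set_integrable_subset[OF int(2)]; use x in auto)+
  then have "(LINT z:{c..x}|lborel. r * g z + s * k z)
      = r * (LINT z:{c..x}|lborel. g z) + s * (LINT z:{c..x}|lborel. k z)" by simp
  moreover have "(LINT z:{c..x}|lborel. g z) = u x - u c" "(LINT z:{c..x}|lborel. k z) = v x - v c"
    using x by (auto intro!: primitive_on_diff[OF assms(1), symmetric] primitive_on_diff[OF assms(2), symmetric])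
  ultimately show "r * u x + s * v x = r * u c + s * v c + (LINT z:{c..x}|lborel. r * g z + s * k z)"
    by (simp add: algebra_simps)
qed

text \<open>The combination (u - v)/h - w again vanishes at 0 together with its first derivative, so
  \<open>primitive_bounds\<close> applies at x = 1. With u = y(t+h), v = y(t) and w = y_t(t) it
  makes the traces differentiable in time.\<close>

lemma H2w0_trace_bounds:
  assumes u: "H2w0 a u u1 u2" and v: "H2w0 a v v1 v2" and w: "H2w0 a w w1 w2"
  shows "\<bar>(u 1 - v 1) / h - w 1\<bar> \<le> sqrt (nrm2 (\<lambda>x. (u2 x - v2 x) / h - w2 x))"
    and "\<bar>(u1 1 - v1 1) / h - w1 1\<bar> \<le> sqrt (nrm2 (\<lambda>x. (u2 x - v2 x) / h - w2 x))"
proof -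
  have eq: "(\<lambda>x. (p x - q x) / h - r x) = (\<lambda>x. 1 * ((1 / h) * p x + (- 1 / h) * q x) + (- 1) * r x)"
    for p q r :: "real \<Rightarrow> real"
    by (auto simp: diff_divide_distrib)
  have prim: "primitive_on 0 1 (\<lambda>x. (u x - v x) / h - w x) (\<lambda>x. (u1 x - v1 x) / h - w1 x)"
    "primitive_on 0 1 (\<lambda>x. (u1 x - v1 x) / h - w1 x) (\<lambda>x. (u2 x - v2 x) / h - w2 x)"
    unfolding eq by (intro primitive_on_lincomb H2w0_primitive[OF u] H2w0_primitive[OF v] H2w0_primitive[OF w])+
  have L2s: "square_integrable lborel (\<lambda>x. indicator {0<..<1} x * u2 x)"
    "square_integrable lborel (\<lambda>x. indicator {0<..<1} x * v2 x)"
    "square_integrable lborel (\<lambda>x. indicator {0<..<1} x * w2 x)"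
    using u v w by (auto simp: H2w0_def L2_iff_square_integrable)
  have "square_integrable lborel (\<lambda>x. (1 / h) * (indicator {0<..<1} x * u2 x)
      + ((- 1 / h) * (indicator {0<..<1} x * v2 x) + (- 1) * (indicator {0<..<1} x * w2 x)))"
    by (intro square_integrable_add square_integrable_cmult L2s)
  also have "(\<lambda>x. (1 / h) * (indicator {0<..<1} x * u2 x)
      + ((- 1 / h) * (indicator {0<..<1} x * v2 x) + (- 1) * (indicator {0<..<1} x * w2 x)))
      = (\<lambda>x. indicator {0<..<1::real} x * ((u2 x - v2 x) / h - w2 x))"
    by (auto simp: indicator_def fun_eq_iff diff_divide_distrib)
  finally have "L2 (\<lambda>x. (u2 x - v2 x) / h - w2 x)"
    unfolding L2_iff_square_integrable .
  note bounds = primitive_bounds[OF prim this, of 1]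
  show "\<bar>(u 1 - v 1) / h - w 1\<bar> \<le> sqrt (nrm2 (\<lambda>x. (u2 x - v2 x) / h - w2 x))"
    "\<bar>(u1 1 - v1 1) / h - w1 1\<bar> \<le> sqrt (nrm2 (\<lambda>x. (u2 x - v2 x) / h - w2 x))"
    using bounds u v w by (auto simp: H2w0_def)
qed

theorem theorem3p1:
  fixes a :: "real \<Rightarrow> real" and \<beta> \<gamma> :: real
    and y yx yxx yxxx yxxxx yt ytx ytxx ytt :: "real \<Rightarrow> real \<Rightarrow> real"
  assumes "WD a \<or> SD a"
    and "\<beta> \<ge> 0" and "\<gamma> \<ge> 0"
    and "classical_solution a \<beta> \<gamma> y yx yxx yxxx yxxxx yt ytx ytxx ytt"
  shows "(\<forall>t\<ge>0. ((\<lambda>s. energy a \<beta> \<gamma> y yx yxx yt s) has_real_derivative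
                  (- (yt t 1)\<^sup>2 - (ytx t 1)\<^sup>2)) (at t within {0..}))
         \<and> (\<forall>s t. 0 \<le> s \<longrightarrow> s \<le> t \<longrightarrow> energy a \<beta> \<gamma> y yx yxx yt t \<le> energy a \<beta> \<gamma> y yx yxx yt s)"
proof -
  note deg = assms(1)
  note sol = assms(4)[unfolded classical_solution_def, rule_format]
  have DA: "DA a (y t) (yx t) (yxx t) (yxxx t) (yxxxx t)" and V: "H2w0 a (yt t) (ytx t) (ytxx t)"
    and ytt: "L2w a (ytt t)" if "t \<ge> 0" for t
    using sol[OF that] by auto
  have U: "H2w0 a (y t) (yx t) (yxx t)" if "t \<ge> 0" for t
    using DA[OF that] by (simp add: DA_def)
  let ?I = "indicator {0<..<1} :: real \<Rightarrow> real"
  have deriv: "((\<lambda>s. energy a \<beta> \<gamma> y yx yxx yt s) has_real_derivative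
      (- (yt t 1)\<^sup>2 - (ytx t 1)\<^sup>2)) (at t within {0..})" if t: "t \<ge> 0" for t
  proof -
    let ?F = "at 0 within {-t..}"
    let ?d2 = "\<lambda>h x. (yxx (t + h) x - yxx t x) / h - ytxx t x"
    have th: "t + h \<ge> 0" if "h \<in> {-t..}" for h using that by auto
    \<comment> \<open>The \<open>nrm2\<close> part alone of the H^2 distance is extracted: it gives
      the derivative of the norm of y_xx and, through the trace bounds, those of both boundary
      terms.\<close>
    have lim_d2: "((\<lambda>h. nrm2 (?d2 h)) \<longlongrightarrow> 0) ?F"
    proof (rule tendsto_sandwich[OF _ _ tendsto_const])
      show "((\<lambda>h. distH2 a (\<lambda>x. (y (t + h) x - y t x) / h) (\<lambda>x. (yxx (t + h) x - yxx t x) / h)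
          (yt t) (ytxx t)) \<longlongrightarrow> 0) ?F"
        using sol[OF t] by blast
    qed (auto simp: nrm2_nonneg nrm2_le_distH2[OF deg])
    then have lim_sqrt: "((\<lambda>h. sqrt (nrm2 (?d2 h))) \<longlongrightarrow> 0) ?F"
      using tendsto_real_sqrt by fastforce
    have "((\<lambda>h. (y (t + h) 1 - y t 1) / h - yt t 1) \<longlongrightarrow> 0) ?F"
      by (rule Lim_null_comparison[OF _ lim_sqrt])
         (use H2w0_trace_bounds(1)[OF U U V] th t in \<open>auto simp: eventually_at_filter\<close>)
    then have dy: "((\<lambda>s. y s 1) has_real_derivative yt t 1) (at t within {0..})"
      by (intro has_real_derivative_within_halfline) (simp add: LIM_zero_iff)
    have "((\<lambda>h. (yx (t + h) 1 - yx t 1) / h - ytx t 1) \<longlongrightarrow> 0) ?F"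
      by (rule Lim_null_comparison[OF _ lim_sqrt])
         (use H2w0_trace_bounds(2)[OF U U V] th t in \<open>auto simp: eventually_at_filter\<close>)
    then have dyx: "((\<lambda>s. yx s 1) has_real_derivative ytx t 1) (at t within {0..})"
      by (intro has_real_derivative_within_halfline) (simp add: LIM_zero_iff)
    have L2yxx: "square_integrable lborel (\<lambda>x. ?I x * yxx s x)" if "s \<ge> 0" for s
      using U[OF that] by (simp add: H2w0_def L2_iff_square_integrable)
    have L2ytxx: "square_integrable lborel (\<lambda>x. ?I x * ytxx t x)"
      using V[OF t] by (simp add: H2w0_def L2_iff_square_integrable)
    have dyxx: "((\<lambda>s. nrm2 (yxx s)) has_real_derivative
        2 * (LINT x|lborel. (?I x * yxx t x) * (?I x * ytxx t x))) (at t within {0..})"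
      unfolding nrm2_eq
    proof (intro has_real_derivative_within_halfline tendsto_square_integral_diff_quotient)
      have "((\<lambda>h. LINT x|lborel. (?I x * ?d2 h x)\<^sup>2) \<longlongrightarrow> 0) ?F"
        using lim_d2 by (simp only: nrm2_eq)
      then show "((\<lambda>h. LINT x|lborel. ((?I x * yxx (t + h) x - ?I x * yxx t x) / h - ?I x * ytxx t x)\<^sup>2) \<longlongrightarrow> 0) ?F"
        by (simp add: right_diff_distrib diff_divide_distrib)
    qed (use L2yxx L2ytxx th t in auto)
    have Wyt: "square_integrable lborel (weighted a (yt s))" if "s \<ge> 0" for s
      using V[OF that] by (intro L2w_square_integrable deg) (simp add: H2w0_def)
    have Wytt: "square_integrable lborel (weighted a (ytt t))"
      by (intro L2w_square_integrable deg ytt t)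
    have dyt: "((\<lambda>s. nrm2w a (yt s)) has_real_derivative
        2 * (LINT x|lborel. weighted a (yt t) x * weighted a (ytt t) x)) (at t within {0..})"
      unfolding nrm2w_eq[OF deg]
    proof (intro has_real_derivative_within_halfline tendsto_square_integral_diff_quotient)
      have "((\<lambda>h. nrm2w a (\<lambda>x. (yt (t + h) x - yt t x) / h - ytt t x)) \<longlongrightarrow> 0) ?F"
        using sol[OF t] by blast
      then show "((\<lambda>h. LINT x|lborel. ((weighted a (yt (t + h)) x - weighted a (yt t) x) / h - weighted a (ytt t) x)\<^sup>2) \<longlongrightarrow> 0) ?F"
        unfolding nrm2w_eq[OF deg] by (simp add: weighted_def right_diff_distrib diff_divide_distrib divide_divide_eq_left mult.commute)
    qed (use Wyt Wytt th t in auto)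
    \<comment> \<open>The integral in the energy is split into two norms, which needs each summand
      to be integrable; hence the restriction to s \<ge> 0.\<close>
    have energy_eq: "energy a \<beta> \<gamma> y yx yxx yt s = 1 / 2 * (nrm2w a (yt s) + nrm2 (yxx s))
        + \<beta> / 2 * (y s 1)\<^sup>2 + \<gamma> / 2 * (yx s 1)\<^sup>2" if "s \<ge> 0" for s
      using U[OF that] V[OF that] unfolding energy_def nrm2w_def nrm2_def
      by (subst set_integral_add) (auto simp: H2w0_def L2_def L2w_def)
    let ?D = "1 / 2 * (2 * (LINT x|lborel. weighted a (yt t) x * weighted a (ytt t) x)
          + 2 * (LINT x|lborel. (?I x * yxx t x) * (?I x * ytxx t x)))
        + \<beta> / 2 * (2 * y t 1 * yt t 1) + \<gamma> / 2 * (2 * yx t 1 * ytx t 1)"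
    have "((\<lambda>s. 1 / 2 * (nrm2w a (yt s) + nrm2 (yxx s))
        + \<beta> / 2 * (y s 1)\<^sup>2 + \<gamma> / 2 * (yx s 1)\<^sup>2) has_real_derivative ?D) (at t within {0..})"
      by (rule derivative_eq_intros dy dyx dyxx dyt refl | simp)+
    then have D: "((\<lambda>s. energy a \<beta> \<gamma> y yx yxx yt s) has_real_derivative ?D) (at t within {0..})"
      by (rule has_field_derivative_transform_within[where d = 1]) (use t energy_eq in auto)
    have Wu4: "square_integrable lborel (weighted a (\<lambda>x. a x * yxxxx t x))"
      using DA[OF t] by (intro L2w_square_integrable deg) (simp add: DA_def)
    have "(LINT x|lborel. weighted a (yt t) x * weighted a (ytt t) x)
        = (LINT x|lborel. - (weighted a (\<lambda>x. a x * yxxxx t x) x * weighted a (yt t) x))"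
    proof (rule integral_cong_AE)
      have "AE x in lborel. x \<in> {0<..<1} \<longrightarrow> ytt t x + a x * yxxxx t x = 0"
        using sol[OF t] by blast
      then show "AE x in lborel. weighted a (yt t) x * weighted a (ytt t) x
          = - (weighted a (\<lambda>x. a x * yxxxx t x) x * weighted a (yt t) x)"
      proof eventually_elim
        case (elim x)
        then have "x \<in> {0<..<1} \<Longrightarrow> ytt t x = - (a x * yxxxx t x)" by simp
        \<comment> \<open>Outside (0,1), where the equation says nothing, both sides are 0 by the
          indicator in \<open>weighted\<close>.\<close>
        then show ?case by (cases "x \<in> {0<..<1}") (auto simp: weighted_def)
      qed
    qed (use Wyt[OF t] Wytt Wu4 in \<open>auto simp: square_integrable_def intro!: borel_measurable_times borel_measurable_uminus\<close>)
    then have eqn: "(LINT x|lborel. weighted a (yt t) x * weighted a (ytt t) x)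
        = - (LINT x|lborel. weighted a (\<lambda>x. a x * yxxxx t x) x * weighted a (yt t) x)"
      by simp
    have bc: "yxxx t 1 = \<beta> * y t 1 + yt t 1" "yxx t 1 = - \<gamma> * yx t 1 - ytx t 1"
      using sol[OF t] by auto
    \<comment> \<open>The equation gives the first pairing a minus sign, so the two pairings
      together are minus the left side of the Green formula.\<close>
    have "?D = - (yt t 1 * yxxx t 1 - ytx t 1 * yxx t 1) + \<beta> * y t 1 * yt t 1 + \<gamma> * yx t 1 * ytx t 1"
      unfolding eqn DA_Green_formula[OF deg DA[OF t] V[OF t], symmetric] by (simp add: algebra_simps)
    also have "\<dots> = - (yt t 1)\<^sup>2 - (ytx t 1)\<^sup>2"
      unfolding bc by (simp add: power2_eq_square algebra_simps)
    finally show ?thesis using D by simp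
  qed
  moreover have "energy a \<beta> \<gamma> y yx yxx yt t \<le> energy a \<beta> \<gamma> y yx yxx yt s" if "0 \<le> s" "s \<le> t" for s t
  proof (rule DERIV_nonpos_imp_decreasing_open[OF that(2)])
    show "continuous_on {s..t} (\<lambda>s. energy a \<beta> \<gamma> y yx yxx yt s)"
      using that deriv unfolding continuous_on_eq_continuous_within
      by (metis DERIV_continuous DERIV_subset atLeastAtMost_iff atLeast_iff order_trans subsetI)
    fix r assume "s < r" "r < t"
    then have r: "r \<in> {0<..}" "r \<ge> 0" using that by auto
    \<comment> \<open>At time 0 the derivative is one-sided, so monotonicity is derived from
      interior times r > 0, where it is two-sided, together with continuity on the closed
      interval.\<close>
    have "at r within {0..} = at r"
      by (rule at_within_open_subset[OF r(1)]) auto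
    with deriv[OF r(2)] show "\<exists>z. ((\<lambda>s. energy a \<beta> \<gamma> y yx yxx yt s) has_real_derivative z) (at r) \<and> z \<le> 0"
      by (intro exI[of _ "- (yt r 1)\<^sup>2 - (ytx r 1)\<^sup>2"]) (auto simp: diff_le_0_iff_le intro: order_trans[of _ 0])
  qed
  ultimately show ?thesis by blast
qed

end
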